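(* Let $n\ge d+2$ and let $(S_i)_{i=1}^n$ be a random bridge in $\mathbb{R}^d$, $S_i=\xi_1+\ldots+\xi_i$ for $1\le i\le n$, whose increments $\xi_1,\ldots,\xi_n$ (random vectors in $\mathbb{R}^d$) satisfy the following assumptions: (Br) Bridge property: $S_n=\xi_1+\ldots+\xi_n=0$ almost surely; (Ex) Exchangeability: for every permutation $\sigma$ of $\{1,\ldots,n\}$, the tuples $(\xi_{\sigma(1)},\ldots,\xi_{\sigma(n)})$ and $(\xi_1,\ldots,\xi_n)$ have the same distribution; (GP') General position: for every $1\le i_1<\ldots<i_d\le n-1$, the probability that $S_{i_1},\ldots,S_{i_d}$ are linearly dependent is $0$. Then for all $k=1,\ldots,n-1$, $$ \mathbb{E}\,M_{n,k}^{(d)}=\frac{1}{(k+1)!}\binom{n-1}{k}\left(\genfrac{[}{]}{0pt}{}{k+1}{d}+\genfrac{[}{]}{0pt}{}{k+1}{d-2}+\ldots\right)=\binom{n-1}{k}\,\mathbb{E}\,M_{k+1,k}^{(d)}. $$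
   Context: $\operatorname{Conv}(x_1,\ldots,x_k)$ denotes the convex hull of the points $x_1,\ldots,x_k\in\mathbb{R}^d$. For a random bridge $(S_i)_{i=1}^n$ in $\mathbb{R}^d$ and $1\le k\le n-1$, $$ M_{n,k}^{(d)}=\frac12\sum_{1\le i_1<\ldots<i_k\le n-1}\mathbf{1}_{\{0\notin\operatorname{Conv}(S_{i_1},\ldots,S_{i_k})\}}. $$ $M_{k+1,k}^{(d)}$ is the same quantity with $k+1$ in place of $n$, that is, $M_{k+1,k}^{(d)}=\frac12\mathbf{1}_{\{0\notin\operatorname{Conv}(S_1,\ldots,S_k)\}}$ for a random bridge $(S_i)_{i=1}^{k+1}$ of the same kind with $k+1$ steps. The Stirling numbers of the first kind $\genfrac{[}{]}{0pt}{}{k+1}{1},\ldots,\genfrac{[}{]}{0pt}{}{k+1}{k+1}$ are defined by $$t(t+1)\cdots(t+k)=\sum_{j=1}^{k+1}\genfrac{[}{]}{0pt}{}{k+1}{j}t^j,$$ with the convention $\genfrac{[}{]}{0pt}{}{k+1}{j}=0$ for $j\le 0$ and for $j>k+1$, so the sum $\genfrac{[}{]}{0pt}{}{k+1}{d}+\genfrac{[}{]}{0pt}{}{k+1}{d-2}+\ldots$ (over the indices $d-2r$, $r=0,1,2,\ldots$) has finitely many non-zero terms.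
   Formalization: For k<d, where (GP') for a bridge with k+1 steps is vacuous and the second equality fails (e.g. for the zero bridge), the (k+1)-step bridge defining M_{k+1,k} is additionally required to have S_1,…,S_k almost surely linearly independent. *)

theory Defs
  imports "HOL-Probability.Probability" "HOL-Combinatorics.Combinatorics"
begin

text \<open>
  The unsigned Stirling numbers of the first kind are \<^const>\<open>stirling\<close>; the polynomial identity
  \<open>t (t + 1) \<dots> (t + k) = (\<Sum>j \<le> k + 1. stirling (k + 1) j * t ^ j)\<close> is the library fact
  \<open>stirling_pochhammer\<close>, and \<open>stirling (k + 1) 0 = 0\<close>.
\<close>

definition partial_sums :: "(nat \<Rightarrow> 'a \<Rightarrow> real ^ 'd) \<Rightarrow> nat \<Rightarrow> 'a \<Rightarrow> real ^ 'd" where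
  "partial_sums \<xi> i \<omega> = (\<Sum>j = 1..i. \<xi> j \<omega>)"

text \<open>
  Linear dependence of a family, not of the set of its values: a family with a repeated vector
  is dependent, although \<open>v ` I\<close> need not be.
\<close>

definition lin_dependent_family :: "nat set \<Rightarrow> (nat \<Rightarrow> real ^ 'd) \<Rightarrow> bool" where
  "lin_dependent_family I v \<longleftrightarrow>
     (\<exists>c :: nat \<Rightarrow> real. (\<exists>i\<in>I. c i \<noteq> 0) \<and> (\<Sum>i\<in>I. c i *\<^sub>R v i) = 0)"

definition bridge_property :: "'a measure \<Rightarrow> nat \<Rightarrow> (nat \<Rightarrow> 'a \<Rightarrow> real ^ 'd) \<Rightarrow> bool" where
  "bridge_property M n \<xi> \<longleftrightarrow> (AE \<omega> in M. partial_sums \<xi> n \<omega> = 0)"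

definition exchangeable :: "'a measure \<Rightarrow> nat \<Rightarrow> (nat \<Rightarrow> 'a \<Rightarrow> real ^ 'd) \<Rightarrow> bool" where
  "exchangeable M n \<xi> \<longleftrightarrow>
     (\<forall>\<sigma>. \<sigma> permutes {1..n} \<longrightarrow>
        distr M (\<Pi>\<^sub>M i\<in>{1..n}. borel) (\<lambda>\<omega>. \<lambda>i\<in>{1..n}. \<xi> (\<sigma> i) \<omega>) =
        distr M (\<Pi>\<^sub>M i\<in>{1..n}. borel) (\<lambda>\<omega>. \<lambda>i\<in>{1..n}. \<xi> i \<omega>))"

text \<open>
  Increasing index tuples \<open>i\<^sub>1 < \<dots> < i\<^sub>m\<close> are encoded as sets of cardinality \<open>m\<close>, here and in
  \<open>M_count\<close>. General position of a bridge in dimension \<open>d\<close> is the case \<open>m = d\<close>.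
\<close>

definition general_position ::
  "'a measure \<Rightarrow> nat \<Rightarrow> nat \<Rightarrow> (nat \<Rightarrow> 'a \<Rightarrow> real ^ 'd) \<Rightarrow> bool" where
  "general_position M n m \<xi> \<longleftrightarrow>
     (\<forall>I. I \<subseteq> {1..n - 1} \<and> card I = m \<longrightarrow>
        (AE \<omega> in M. \<not> lin_dependent_family I (\<lambda>i. partial_sums \<xi> i \<omega>)))"

text \<open>
  For \<open>n \<ge> d + 1\<close> the minimum below is \<open>d\<close>. For \<open>n \<le> d\<close> there are no \<open>d\<close> indices to choose, and the
  condition for \<open>m = d\<close> holds vacuously, even for the zero bridge; a bridge of so few steps is in general
  position if \<open>S\<^sub>1, \<dots>, S\<^sub>n\<^sub>-\<^sub>1\<close> are almost surely linearly independent.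
\<close>

definition random_bridge :: "'a measure \<Rightarrow> nat \<Rightarrow> (nat \<Rightarrow> 'a \<Rightarrow> real ^ 'd) \<Rightarrow> bool" where
  "random_bridge M n \<xi> \<longleftrightarrow>
     prob_space M \<and>
     (\<forall>i\<in>{1..n}. \<xi> i \<in> borel_measurable M) \<and>
     bridge_property M n \<xi> \<and>
     exchangeable M n \<xi> \<and>
     general_position M n (min CARD('d) (n - 1)) \<xi>"

definition M_count :: "nat \<Rightarrow> nat \<Rightarrow> (nat \<Rightarrow> 'a \<Rightarrow> real ^ 'd) \<Rightarrow> 'a \<Rightarrow> real" where
  "M_count n k \<xi> \<omega> =
     1 / 2 * (\<Sum>I | I \<subseteq> {1..n - 1} \<and> card I = k.
                of_bool (0 \<notin> convex hull ((\<lambda>i. partial_sums \<xi> i \<omega>) ` I)))"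

end

theory Submission
  imports Defs
begin

text \<open>
  By separation, \<open>0\<close> lies outside the convex hull of partial sums iff some \<open>y\<close> has positive inner product
  with all of them. For vectors \<open>b\<^sub>1, \<dots>, b\<^sub>m\<close> with sum zero that span the space, consider the
  chains of proper nonempty subsets \<open>A\<close> of \<open>{1..m}\<close> and, for each chain, the open cone of all \<open>y\<close> that are
  positive on every \<open>b(A) = (\<Sum>i\<in>A. b\<^sub>i)\<close>. A nonempty open cone has Euler characteristic
  \<open>(-1)^d\<close>; for fixed \<open>y \<noteq> 0\<close> the alternating sum over the chains whose cone contains \<open>y\<close> vanishes, and
  for \<open>y = 0\<close> it is \<open>1\<close>. So the alternating sum over chains of the indicators of nonempty cones is
  \<open>(-1)^d\<close>.

  Chains are ordered partitions. Symmetrising over the order of the blocks turns this relation into a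
  recursion for the number of orderings of \<open>m\<close> vectors in general position for which \<open>0\<close> is outside
  the hull, because merging blocks preserves general position. Since
  \<open>\<Sum>\<^sub>j (-1)^j surj(m, j) / j! * stirling j i = 0\<close> for \<open>i < m\<close>, the recursion is solved by
  \<open>2 * (stirling m d + stirling m (d - 2) + \<dots>)\<close>.

  For a bridge, exchangeability shows that permuting the blocks cut out by an index set only permutes the
  index sets. Averaging over these permutations reduces the expectation to the deterministic count.
\<close>

section \<open>The Euler relation for chains of subsets\<close>

text \<open>
  The exponent is the codimension of the cell \<open>{y. \<forall>x\<in>X. sgn (v x \<bullet> y) = s x}\<close>, so this is its
  Euler characteristic with compact support up to the factor \<open>(-1) ^ DIM('e)\<close>.
\<close>

definition cell_sign :: "('i \<Rightarrow> 'e::euclidean_space) \<Rightarrow> 'i set \<Rightarrow> ('i \<Rightarrow> real) \<Rightarrow> int" where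
  "cell_sign v X s =
     (if \<exists>y. \<forall>x\<in>X. sgn (v x \<bullet> y) = s x then (-1) ^ dim (v ` {x \<in> X. s x = 0}) else 0)"

lemma cell_sign_cong:
  assumes "\<And>x. x \<in> X \<Longrightarrow> s x = t x"
  shows "cell_sign v X s = cell_sign v X t"
proof -
  have "{x \<in> X. s x = 0} = {x \<in> X. t x = 0}" using assms by auto
  then show ?thesis using assms by (simp add: cell_sign_def)
qed

lemma sgn_pos_combination:
  fixes p q :: real
  assumes "0 < p" "0 < q" "sgn a = sgn b"
  shows "sgn (p * a + q * b) = sgn a"
proof (cases a "0::real" rule: linorder_cases)
  case less
  then have "b < 0" using assms(3) by (simp add: sgn_if split: if_splits)
  with less assms have "p * a + q * b < 0" by (intro add_neg_neg mult_pos_neg)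
  with less show ?thesis by simp
next
  case equal
  then show ?thesis using assms(3) by (simp add: sgn_if split: if_splits)
next
  case greater
  then have "b > 0" using assms(3) by (simp add: sgn_if split: if_splits)
  with greater assms have "p * a + q * b > 0" by (intro add_pos_pos mult_pos_pos)
  with greater show ?thesis by simp
qed

text \<open>Strict sign conditions are open, so they survive a small step along \<open>w\<close>;
  the conditions with sign 0 survive because \<open>w\<close> is orthogonal to their
  vectors.\<close>

lemma perturb_within_cell:
  fixes v :: "'i \<Rightarrow> 'e::euclidean_space"
  assumes "finite X" and y: "\<forall>x\<in>X. sgn (v x \<bullet> y) = s x"
    and w: "\<And>x. x \<in> X \<Longrightarrow> s x = 0 \<Longrightarrow> v x \<bullet> w = 0"
  shows "\<exists>e>0. \<forall>x\<in>X. sgn (v x \<bullet> (y + e *\<^sub>R w)) = s x"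
proof -
  have "\<forall>\<^sub>F e in at_right 0. \<forall>x\<in>X. sgn (v x \<bullet> (y + e *\<^sub>R w)) = s x"
  proof (rule eventually_ball_finite[OF assms(1)], rule ballI)
    fix x assume x: "x \<in> X"
    have lim: "((\<lambda>e. v x \<bullet> (y + e *\<^sub>R w)) \<longlongrightarrow> v x \<bullet> (y + 0 *\<^sub>R w)) (at_right 0)"
      by (intro tendsto_intros)
    consider "v x \<bullet> y > 0" | "v x \<bullet> y < 0" | "v x \<bullet> y = 0" by linarith
    then show "\<forall>\<^sub>F e in at_right 0. sgn (v x \<bullet> (y + e *\<^sub>R w)) = s x"
    proof cases
      case 1
      then have "s x = 1" using y x by auto
      moreover have "\<forall>\<^sub>F e in at_right 0. 0 < v x \<bullet> (y + e *\<^sub>R w)"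
        using order_tendstoD(1)[OF lim, of 0] 1 by simp
      ultimately show ?thesis by (auto elim: eventually_mono)
    next
      case 2
      then have "s x = -1" using y x by auto
      moreover have "\<forall>\<^sub>F e in at_right 0. v x \<bullet> (y + e *\<^sub>R w) < 0"
        using order_tendstoD(2)[OF lim, of 0] 2 by simp
      ultimately show ?thesis by (auto elim: eventually_mono)
    next
      case 3
      then have "s x = 0" using y x by auto
      then show ?thesis using w[OF x] 3 by (simp add: inner_right_distrib)
    qed
  qed
  then have "\<forall>\<^sub>F e in at_right 0. 0 < e \<and> (\<forall>x\<in>X. sgn (v x \<bullet> (y + e *\<^sub>R w)) = s x)"
    using eventually_at_right_less by (rule eventually_conj[rotated])
  then show ?thesis using eventually_happens'[OF trivial_limit_at_right_real] by blast
qed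

text \<open>Additivity of the Euler characteristic. The zero set of \<open>v x\<close> contains the
  cell, misses it, or cuts it into two halves and a slice of one dimension less. In the last case
  the halves count twice and the slice once with the opposite sign, which leaves the value of the
  cell.\<close>

lemma cell_sign_split:
  fixes v :: "'i \<Rightarrow> 'e::euclidean_space"
  assumes "finite X" "x \<notin> X"
  shows "cell_sign v X s = (\<Sum>e\<in>{-1, 0, 1}. cell_sign v (insert x X) (s(x := e)))"
proof -
  let ?C = "\<lambda>y. \<forall>z\<in>X. sgn (v z \<bullet> y) = s z"
  let ?E = "v ` {z \<in> X. s z = 0}"
  let ?P = "\<lambda>e. \<exists>y. ?C y \<and> sgn (v x \<bullet> y) = e"
  have cell: "(\<forall>z\<in>insert x X. sgn (v z \<bullet> y) = (s(x := e)) z) \<longleftrightarrow> ?C y \<and> sgn (v x \<bullet> y) = e" for e y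
    using assms(2) by auto
  have zeros: "v ` {z \<in> insert x X. (s(x := e)) z = 0} = (if e = 0 then insert (v x) ?E else ?E)" for e
    proof -
    have "{z \<in> insert x X. (s(x := e)) z = 0} = (if e = 0 then insert x {z \<in> X. s z = 0} else {z \<in> X. s z = 0})"
      using assms(2) by auto
    then show ?thesis by simp
  qed
  have cs: "cell_sign v (insert x X) (s(x := e)) =
      (if ?P e then (-1) ^ dim (if e = 0 then insert (v x) ?E else ?E) else 0)" for e
    unfolding cell_sign_def zeros cell ..
  have "(\<Sum>e\<in>{-1, 0, 1}. cell_sign v (insert x X) (s(x := e))) =
      (if ?P (-1) then (-1) ^ dim ?E else 0) + (if ?P 0 then (-1) ^ dim (insert (v x) ?E) else 0)
      + (if ?P 1 then (-1) ^ dim ?E else 0)"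
    unfolding cs by simp
  also have "\<dots> = cell_sign v X s"
  proof (cases "\<exists>y. ?C y")
    case False
    then have "\<not> ?P e" for e by blast
    with False show ?thesis by (simp add: cell_sign_def)
  next
    case True
    then obtain y where y: "?C y" by blast
    have csX: "cell_sign v X s = (-1) ^ dim ?E" using True by (simp add: cell_sign_def)
    show ?thesis
    proof (cases "v x \<in> span ?E")
      case span: True
      have zero: "v x \<bullet> z = 0" if "?C z" for z
      proof -
        have "orthogonal z (v x)"
          using span that by (intro orthogonal_to_span[OF span])
            (auto simp: orthogonal_def inner_commute sgn_zero_iff)
        then show ?thesis by (simp add: orthogonal_def inner_commute)
      qed
      have "?P 0" using y zero[OF y] by auto
      moreover have "\<not> ?P 1" "\<not> ?P (-1)" using zero by auto
      ultimately show ?thesis using span csX by (simp add: dim_insert)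
    next
      case nspan: False
      \<comment> \<open>\<open>w\<close> is the part of \<open>v x\<close> orthogonal to the vectors
        with sign 0. A small move along \<open>w\<close> or \<open>- w\<close> stays in the cell and
        changes the product with \<open>v x\<close> strictly, so a point of the slice has points of
        both halves nearby.\<close>
      obtain p w where p: "p \<in> span ?E" and w: "\<And>u. u \<in> span ?E \<Longrightarrow> orthogonal w u"
        and vx: "v x = p + w"
        by (rule orthogonal_subspace_decomp_exists[of ?E "v x"]) (rule that)
      have "w \<noteq> 0" using nspan p vx by (intro notI) simp
      then have vw: "v x \<bullet> w > 0"
        using w[OF p] by (simp add: vx inner_add_left orthogonal_def inner_commute[of p w])
      have wz: "v z \<bullet> w = 0" if "z \<in> X" "s z = 0" for z
        using w[of "v z"] that by (auto simp: orthogonal_def inner_commute intro: span_base)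
      have d: "dim (insert (v x) ?E) = Suc (dim ?E)" using nspan by (simp add: dim_insert)
      show ?thesis
      proof (cases "?P 0")
        case True
        then obtain y0 where y0: "?C y0" "v x \<bullet> y0 = 0" by (auto simp: sgn_zero_iff)
        have "?P 1"
        proof -
          obtain e where "e > 0" "?C (y0 + e *\<^sub>R w)"
            using perturb_within_cell[OF assms(1) y0(1), of w] wz by blast
          then show ?thesis using y0(2) vw
            by (intro exI[of _ "y0 + e *\<^sub>R w"]) (simp add: inner_right_distrib)
        qed
        moreover have "?P (-1)"
        proof -
          obtain e where "e > 0" "?C (y0 + e *\<^sub>R (- w))"
            using perturb_within_cell[OF assms(1) y0(1), of "- w"] wz by auto
          then show ?thesis using y0(2) vw
            by (intro exI[of _ "y0 + e *\<^sub>R (- w)"]) (simp add: inner_diff_right)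
        qed
        ultimately show ?thesis using True d csX by simp
      next
        case False
        have "?P 1 \<or> ?P (-1)"
        proof -
          have "v x \<bullet> y \<noteq> 0" using False y by auto
          then have "sgn (v x \<bullet> y) = 1 \<or> sgn (v x \<bullet> y) = -1" by (auto simp: sgn_if)
          then show ?thesis using y by blast
        qed
        moreover have "\<not> (?P 1 \<and> ?P (-1))"
        proof
          assume "?P 1 \<and> ?P (-1)"
          then obtain y1 y2 where y1: "?C y1" "v x \<bullet> y1 > 0" and y2: "?C y2" "v x \<bullet> y2 < 0"
            by (auto simp: sgn_1_pos sgn_1_neg)
          \<comment> \<open>The cell is convex, and these weights put the combination of
            \<open>y1\<close> and \<open>y2\<close> on the hyperplane, although the slice is assumed
            empty.\<close>
          let ?y = "(- (v x \<bullet> y2)) *\<^sub>R y1 + (v x \<bullet> y1) *\<^sub>R y2"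
          have "sgn (v z \<bullet> ?y) = s z" if "z \<in> X" for z
          proof -
            have "sgn (v z \<bullet> ?y) = sgn ((- (v x \<bullet> y2)) * (v z \<bullet> y1) + (v x \<bullet> y1) * (v z \<bullet> y2))"
              by (simp add: inner_diff_right inner_right_distrib)
            also have "\<dots> = sgn (v z \<bullet> y1)"
              using y1 y2 that by (intro sgn_pos_combination) auto
            finally show ?thesis using y1 that by simp
          qed
          moreover have "v x \<bullet> ?y = 0" by (simp add: inner_diff_right inner_right_distrib)
          ultimately show False using False by (metis sgn_zero)
        qed
        ultimately show ?thesis using False csX by auto
      qed
    qed
  qed
  finally show ?thesis by simp
qed

lemma cell_sign_sum_override:
  assumes "finite Z" "finite Y" "Y \<inter> Z = {}"
  shows "cell_sign v Y s = (\<Sum>t\<in>Z \<rightarrow>\<^sub>E {-1, 0, 1}. cell_sign v (Y \<union> Z) (override_on s t Z))"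
  using assms
proof (induction Z rule: finite_induct)
  case empty
  then show ?case by simp
next
  case (insert x Z)
  let ?S = "{-1, 0, 1 :: real}"
  have ov: "override_on s (g(x := e)) (insert x Z) = (override_on s g Z)(x := e)" for g e
    using insert.hyps by (auto simp: override_on_def)
  have "(\<Sum>t\<in>insert x Z \<rightarrow>\<^sub>E ?S. cell_sign v (Y \<union> insert x Z) (override_on s t (insert x Z)))
      = (\<Sum>(e, g)\<in>?S \<times> (Z \<rightarrow>\<^sub>E ?S). cell_sign v (insert x (Y \<union> Z)) ((override_on s g Z)(x := e)))"
    unfolding PiE_insert_eq
    by (subst sum.reindex[OF inj_combinator[OF insert.hyps(2)]])
       (simp add: o_def case_prod_unfold ov del: fun_upd_apply)
  also have "\<dots> = (\<Sum>e\<in>?S. \<Sum>g\<in>Z \<rightarrow>\<^sub>E ?S. cell_sign v (insert x (Y \<union> Z)) ((override_on s g Z)(x := e)))"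
    by (subst sum.cartesian_product) simp
  also have "\<dots> = (\<Sum>g\<in>Z \<rightarrow>\<^sub>E ?S. \<Sum>e\<in>?S. cell_sign v (insert x (Y \<union> Z)) ((override_on s g Z)(x := e)))"
    by (rule sum.swap)
  also have "\<dots> = (\<Sum>g\<in>Z \<rightarrow>\<^sub>E ?S. cell_sign v (Y \<union> Z) (override_on s g Z))"
    using insert.hyps insert.prems by (intro sum.cong refl cell_sign_split[symmetric]) auto
  also have "\<dots> = cell_sign v Y s" using insert by simp
  finally show ?case by simp
qed

text \<open>The cell given by \<open>Y\<close> is the disjoint union of the cells of the finer
  arrangement indexed by \<open>X\<close>; \<open>cell_sign_split\<close> is iterated over
  \<open>X - Y\<close>.\<close>

lemma cell_sign_sum:
  assumes "finite X" "Y \<subseteq> X" "s ` Y \<subseteq> {-1, 0, 1}"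
  shows "cell_sign v Y s =
    (\<Sum>t | t \<in> X \<rightarrow>\<^sub>E {-1, 0, 1} \<and> (\<forall>x\<in>Y. t x = s x). cell_sign v X t)"
proof -
  let ?Z = "X - Y"
  have "cell_sign v Y s = (\<Sum>t\<in>?Z \<rightarrow>\<^sub>E {-1, 0, 1}. cell_sign v (Y \<union> ?Z) (override_on s t ?Z))"
    using assms by (intro cell_sign_sum_override) (auto intro: finite_subset)
  also have "Y \<union> ?Z = X" using assms by auto
  also have "(\<Sum>t\<in>?Z \<rightarrow>\<^sub>E {-1, 0, 1}. cell_sign v X (override_on s t ?Z)) =
    (\<Sum>t | t \<in> X \<rightarrow>\<^sub>E {-1, 0, 1} \<and> (\<forall>x\<in>Y. t x = s x). cell_sign v X t)"
  proof (rule sum.reindex_bij_witness[where i = "\<lambda>t. restrict t ?Z"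
        and j = "\<lambda>t. restrict (override_on s t ?Z) X"], goal_cases)
    case (1 a)
    then show ?case by (fastforce simp: override_on_def fun_eq_iff)
  next
    case (2 a)
    then show ?case using assms(2,3) by (auto simp: override_on_def image_subset_iff PiE_iff)
  next
    case (3 b)
    then show ?case using assms(2) by (fastforce simp: override_on_def fun_eq_iff PiE_iff extensional_def)
  next
    case (4 b)
    then show ?case by (auto simp: PiE_iff)
  next
    case (5 a)
    then show ?case by (intro cell_sign_cong) simp
  qed
  finally show ?thesis .
qed

section \<open>Alternating sums over chains of subsets\<close>

definition subset_chains :: "'i set \<Rightarrow> 'i set set set" where
  "subset_chains V = {c. c \<subseteq> {A. A \<subset> V \<and> A \<noteq> {}} \<and> (\<forall>A\<in>c. \<forall>B\<in>c. A \<subseteq> B \<or> B \<subseteq> A)}"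

lemma finite_subset_chains: "finite V \<Longrightarrow> finite (subset_chains V)"
  by (rule finite_subset[of _ "Pow (Pow V)"]) (auto simp: subset_chains_def)

lemma finite_subset_chain: "finite V \<Longrightarrow> c \<in> subset_chains V \<Longrightarrow> finite c"
  by (rule finite_subset[of _ "Pow V"]) (auto simp: subset_chains_def)

lemma Union_chain_mem:
  assumes "finite F" "F \<noteq> {}" "\<forall>A\<in>F. \<forall>B\<in>F. A \<subseteq> B \<or> B \<subseteq> A"
  shows "\<Union>F \<in> F"
proof -
  obtain m where m: "m \<in> F" "\<forall>B\<in>F. m \<subseteq> B \<longrightarrow> m = B"
    using finite_has_maximal[OF assms(1,2)] by metis
  then have "\<forall>B\<in>F. B \<subseteq> m" using assms(3) by blast
  with m have "\<Union>F = m" by blast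
  with m show ?thesis by simp
qed

text \<open>
  Adding or removing \<open>insert i (U c)\<close>, where \<open>U c\<close> is the largest member of the chain \<open>c\<close> that avoids
  \<open>i\<close>, is a sign-reversing involution.
\<close>

lemma alternating_positive_chains:
  fixes a :: "'i \<Rightarrow> real"
  assumes "finite V" "sum a V = 0" "i \<in> V" "a i > 0"
  shows "(\<Sum>c | c \<in> subset_chains V \<and> (\<forall>A\<in>c. sum a A > 0). (-1) ^ card c) = (0 :: int)"
proof -
  define S where "S = {c \<in> subset_chains V. \<forall>A\<in>c. sum a A > 0}"
  define U where "U c = \<Union>{A \<in> c. i \<notin> A}" for c
  define \<phi> where "\<phi> c = (if insert i (U c) \<in> c then c - {insert i (U c)} else insert (insert i (U c)) c)" for c
  have U\<phi>: "U (\<phi> c) = U c" for c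
  proof -
    have "{A \<in> \<phi> c. i \<notin> A} = {A \<in> c. i \<notin> A}" by (auto simp: \<phi>_def)
    then show ?thesis by (simp add: U_def)
  qed
  have \<phi>\<phi>: "\<phi> (\<phi> c) = c" for c
    unfolding \<phi>_def[of "\<phi> c"] U\<phi> by (auto simp: \<phi>_def)
  have \<phi>S: "\<phi> c \<in> S" if c: "c \<in> S" for c
  proof (cases "insert i (U c) \<in> c")
    case True
    then show ?thesis using c by (auto simp: S_def \<phi>_def subset_chains_def)
  next
    case False
    let ?T = "insert i (U c)"
    have ch: "\<forall>A\<in>c. \<forall>B\<in>c. A \<subseteq> B \<or> B \<subseteq> A" and cV: "\<And>A. A \<in> c \<Longrightarrow> A \<subset> V \<and> A \<noteq> {}"
      using c by (auto simp: S_def subset_chains_def)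
    have fin: "finite c" using c assms(1) by (auto simp: S_def intro: finite_subset_chain)
    \<comment> \<open>If no member avoids \<open>i\<close>, then \<open>U c\<close> is the empty
      union and the inserted set is \<open>{i}\<close>. Otherwise \<open>U c\<close> is itself a
      member of the chain. In both cases its sum is nonnegative, so adding \<open>i\<close> makes it
      positive.\<close>
    have "U c = {} \<or> U c \<in> {A \<in> c. i \<notin> A}"
    proof (cases "{A \<in> c. i \<notin> A} = {}")
      case True
      then show ?thesis by (simp only: U_def Union_empty simp_thms)
    next
      case False
      then show ?thesis unfolding U_def using fin ch by (intro disjI2 Union_chain_mem) auto
    qed
    then have Ui: "i \<notin> U c" and Upos: "sum a (U c) \<ge> 0" and UV: "U c \<subseteq> V"
      using c cV by (auto simp: S_def less_imp_le)
    have "finite (U c)" using UV assms(1) finite_subset by blast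
    then have pos: "sum a ?T > 0" using Ui Upos assms(4) by simp
    then have "?T \<noteq> V" using assms(2) by auto
    then have T: "?T \<subset> V" using UV assms(3) by auto
    have cmp: "A \<subseteq> ?T \<or> ?T \<subseteq> A" if A: "A \<in> c" for A
    proof (cases "i \<in> A")
      case True
      then have "U c \<subseteq> A" using ch A unfolding U_def by blast
      with True show ?thesis by blast
    next
      case False
      with A show ?thesis by (auto simp: U_def)
    qed
    have "insert ?T c \<in> S" unfolding S_def subset_chains_def mem_Collect_eq
    proof (intro conjI ballI subsetI)
      fix A assume "A \<in> insert ?T c"
      then consider "A = ?T" | "A \<in> c" by blast
      then show "A \<in> {A. A \<subset> V \<and> A \<noteq> {}}"
      proof cases
        case 1
        then show ?thesis using T by simp
      qed (use cV in simp)
    next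
      fix A assume "A \<in> insert ?T c"
      then consider "A = ?T" | "A \<in> c" by blast
      then show "sum a A > 0"
      proof cases
        case 1
        with pos show ?thesis by (simp only:)
      qed (use c in \<open>simp add: S_def\<close>)
    next
      fix A B assume "A \<in> insert ?T c" "B \<in> insert ?T c"
      then show "A \<subseteq> B \<or> B \<subseteq> A"
        using ch cmp by (elim insertE) (simp_all only: order_refl simp_thms, blast+)
    qed
    then show ?thesis using False by (simp add: \<phi>_def)
  qed
  have sgn\<phi>: "(-1 :: int) ^ card (\<phi> c) = - ((-1) ^ card c)" if "c \<in> S" for c
  proof -
    have fin: "finite c" using that assms(1) by (auto simp: S_def intro: finite_subset_chain)
    show ?thesis
    proof (cases "insert i (U c) \<in> c")
      case True
      then have "\<phi> c = c - {insert i (U c)}" by (simp add: \<phi>_def)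
      then have "card c = Suc (card (\<phi> c))" using card.remove[OF fin True] by (simp only:)
      then show ?thesis by simp
    next
      case False
      then have "\<phi> c = insert (insert i (U c)) c" by (simp add: \<phi>_def)
      then have "card (\<phi> c) = Suc (card c)" using card_insert_disjoint[OF fin False] by (simp only:)
      then show ?thesis by simp
    qed
  qed
  have "(\<Sum>c\<in>S. (-1 :: int) ^ card c) = (\<Sum>c\<in>S. (-1) ^ card (\<phi> c))"
    by (rule sum.reindex_bij_witness[where i = \<phi> and j = \<phi>]) (auto simp: \<phi>\<phi> \<phi>S)
  also have "\<dots> = - (\<Sum>c\<in>S. (-1) ^ card c)" by (simp add: sgn\<phi> sum_negf)
  finally show ?thesis by (simp add: S_def)
qed

text \<open>Each cone is refined into cells of the arrangement of all subset sums, and the two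
  summations are exchanged. A cell containing some \<open>y \<noteq> 0\<close> then carries the
  alternating sum of \<open>alternating_positive_chains\<close>, which is zero; only the cell of the
  origin is left.\<close>

lemma euler_relation_chains:
  fixes b :: "'i \<Rightarrow> 'e::euclidean_space"
  assumes fin: "finite V" and sum0: "(\<Sum>i\<in>V. b i) = 0"
    and total: "\<And>y. (\<forall>i\<in>V. b i \<bullet> y = 0) \<Longrightarrow> y = 0"
  shows "(\<Sum>c\<in>subset_chains V. (-1) ^ card c * of_bool (\<exists>y. \<forall>A\<in>c. (\<Sum>i\<in>A. b i) \<bullet> y > 0)) =
    ((-1) ^ DIM('e) :: int)"
proof -
  define v where "v A = (\<Sum>i\<in>A. b i)" for A
  let ?X = "Pow V"
  let ?T = "?X \<rightarrow>\<^sub>E {-1, 0, 1 :: real}"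
  have finT: "finite ?T" using fin by (intro finite_PiE) auto
  have vy: "v A \<bullet> y = (\<Sum>i\<in>A. b i \<bullet> y)" for A y by (simp add: v_def inner_sum_left)
  have cone: "of_bool (\<exists>y. \<forall>A\<in>c. (\<Sum>i\<in>A. b i) \<bullet> y > 0) =
      (\<Sum>t | t \<in> ?T \<and> (\<forall>A\<in>c. t A = 1). cell_sign v ?X t)" if "c \<in> subset_chains V" for c
  proof -
    have "of_bool (\<exists>y. \<forall>A\<in>c. (\<Sum>i\<in>A. b i) \<bullet> y > 0) = cell_sign v c (\<lambda>_. 1)"
      by (simp add: cell_sign_def v_def sgn_1_pos)
    also have "\<dots> = (\<Sum>t | t \<in> ?T \<and> (\<forall>A\<in>c. t A = 1). cell_sign v ?X t)"
      using that fin by (intro cell_sign_sum) (auto simp: subset_chains_def)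
    finally show ?thesis .
  qed
  have inner: "cell_sign v ?X t * (\<Sum>c | c \<in> subset_chains V \<and> (\<forall>A\<in>c. t A = 1). (-1) ^ card c) =
      (if t = (\<lambda>A\<in>?X. 0) then (-1) ^ DIM('e) else 0)" if t: "t \<in> ?T" for t
  proof (cases "\<exists>y. \<forall>A\<in>?X. sgn (v A \<bullet> y) = t A")
    case False
    then have "t \<noteq> (\<lambda>A\<in>?X. 0)" by (metis inner_zero_right restrict_apply' sgn_zero)
    moreover have "cell_sign v ?X t = 0" unfolding cell_sign_def by (rule if_not_P[OF False])
    ultimately show ?thesis by simp
  next
    case True
    then obtain y where y: "\<forall>A\<in>?X. sgn (v A \<bullet> y) = t A" by blast
    show ?thesis
    proof (cases "y = 0")
      case True
      then have t0: "t A = 0" if "A \<in> ?X" for A using y that by auto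
      then have tt: "t = (\<lambda>A\<in>?X. 0)" using t by (auto simp: fun_eq_iff PiE_iff extensional_def)
      have "{c \<in> subset_chains V. \<forall>A\<in>c. t A = 1} = {{}}"
      proof (intro equalityI subsetI)
        fix c assume "c \<in> {c \<in> subset_chains V. \<forall>A\<in>c. t A = 1}"
        then have "\<forall>A\<in>c. A \<in> ?X \<and> t A = 1" by (auto simp: subset_chains_def)
        then have "c = {}" using t0 by fastforce
        then show "c \<in> {{}}" by simp
      qed (simp add: subset_chains_def)
      moreover have "dim (v ` ?X) = DIM('e)"
      proof -
        have "span (v ` ?X) = UNIV"
        proof (rule ccontr)
          assume "span (v ` ?X) \<noteq> UNIV"
          then obtain w where w: "w \<noteq> 0" "\<And>u. u \<in> span (v ` ?X) \<Longrightarrow> orthogonal w u"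
            using orthogonal_to_subspace_exists_gen[of "v ` ?X" UNIV] by auto
          have "b i \<bullet> w = 0" if "i \<in> V" for i
          proof -
            have "v {i} \<in> span (v ` ?X)" using that by (intro span_base) auto
            then show ?thesis using w(2)[of "b i"] by (simp add: v_def inner_commute[of "b i"] orthogonal_def)
          qed
          with total w(1) show False by blast
        qed
        then show ?thesis by (metis dim_UNIV dim_span)
      qed
      moreover have "{A \<in> ?X. t A = 0} = ?X" using t0 by auto
      moreover have "\<exists>y. \<forall>A\<in>?X. sgn (v A \<bullet> y) = t A" using y by blast
      ultimately show ?thesis using tt by (simp add: cell_sign_def)
    next
      case False
      then have "\<exists>i\<in>V. b i \<bullet> y \<noteq> 0" using total by blast
      moreover have z: "(\<Sum>i\<in>V. b i \<bullet> y) = 0" using sum0 by (simp flip: inner_sum_left)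
      ultimately obtain i where i: "i \<in> V" "b i \<bullet> y > 0"
        using sum_nonneg_eq_0_iff[OF fin, of "\<lambda>i. - (b i \<bullet> y)"] by (force simp: sum_negf not_less)
      have "sgn (v {i} \<bullet> y) = t {i}" using y i(1) by blast
      then have "t {i} \<noteq> 0" using i(2) by (auto simp: v_def)
      then have "t \<noteq> (\<lambda>A\<in>?X. 0)" using i by auto
      moreover have "(\<Sum>c | c \<in> subset_chains V \<and> (\<forall>A\<in>c. t A = 1). (-1) ^ card c) = (0 :: int)"
      proof -
        have "t A = 1 \<longleftrightarrow> (\<Sum>i\<in>A. b i \<bullet> y) > 0" if "c \<in> subset_chains V" "A \<in> c" for c A
        proof -
          have "A \<in> ?X" using that unfolding subset_chains_def by blast
          then have "t A = sgn (v A \<bullet> y)" using y by (metis (no_types))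
          then show ?thesis by (simp add: sgn_1_pos vy)
        qed
        then have "{c \<in> subset_chains V. \<forall>A\<in>c. t A = 1} = {c \<in> subset_chains V. \<forall>A\<in>c. (\<Sum>i\<in>A. b i \<bullet> y) > 0}"
          by (intro Collect_cong conj_cong refl ball_cong)
        then show ?thesis using alternating_positive_chains[OF fin z i] by (simp only:)
      qed
      ultimately show ?thesis by (simp only: mult_zero_right if_False)
    qed
  qed
  have "(\<Sum>c\<in>subset_chains V. (-1) ^ card c * of_bool (\<exists>y. \<forall>A\<in>c. (\<Sum>i\<in>A. b i) \<bullet> y > 0)) =
      (\<Sum>c\<in>subset_chains V. \<Sum>t | t \<in> ?T \<and> (\<forall>A\<in>c. t A = 1). (-1) ^ card c * cell_sign v ?X t)"
    by (rule sum.cong[OF refl], subst cone, assumption, rule sum_distrib_left)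
  also have "\<dots> = (\<Sum>t\<in>?T. \<Sum>c | c \<in> subset_chains V \<and> (\<forall>A\<in>c. t A = 1). (-1) ^ card c * cell_sign v ?X t)"
    by (rule sum.swap_restrict[OF finite_subset_chains[OF fin] finT])
  also have "\<dots> = (\<Sum>t\<in>?T. if t = (\<lambda>A\<in>?X. 0) then (-1) ^ DIM('e) else 0)"
    by (rule sum.cong[OF refl], subst inner[symmetric], assumption, subst mult.commute, rule sum_distrib_right[symmetric])
  also have "\<dots> = (-1) ^ DIM('e)"
    using finT by (subst sum.delta) auto
  finally show ?thesis .
qed

section \<open>Ordered partitions as surjections\<close>

definition surjections :: "'i set \<Rightarrow> nat \<Rightarrow> ('i \<Rightarrow> nat) set" where
  "surjections V j = {g \<in> V \<rightarrow>\<^sub>E {..<j}. g ` V = {..<j}}"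

lemma finite_surjections: "finite V \<Longrightarrow> finite (surjections V j)"
  unfolding surjections_def by (rule finite_subset[of _ "V \<rightarrow>\<^sub>E {..<j}"]) (auto intro: finite_PiE)

lemma surjections_lessD: "g \<in> surjections V j \<Longrightarrow> i \<in> V \<Longrightarrow> g i < j"
  by (auto simp: surjections_def)

lemma surjections_obtain:
  assumes "g \<in> surjections V j" "l < j"
  obtains i where "i \<in> V" "g i = l"
proof -
  have "l \<in> g ` V" using assms by (auto simp: surjections_def)
  then show ?thesis using that by auto
qed

lemma surjections_le_card:
  assumes "finite V" "g \<in> surjections V j"
  shows "j \<le> card V"
proof -
  have "card (g ` V) = j" using assms(2) by (simp add: surjections_def)
  then show ?thesis using card_image_le[OF assms(1), of g] by simp
qed

lemma surjections_nonempty: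
  assumes "finite V" "0 < j" "j \<le> card V"
  shows "surjections V j \<noteq> {}"
proof -
  obtain e where e: "bij_betw e V {0..<card V}" using ex_bij_betw_finite_nat[OF assms(1)] by blast
  define g where "g = (\<lambda>i\<in>V. min (e i) (j - 1))"
  have "g ` V = (\<lambda>n. min n (j - 1)) ` {0..<card V}"
    unfolding bij_betw_imp_surj_on[OF e, symmetric] image_image by (simp add: g_def)
  also have "\<dots> = {..<j}"
  proof (intro equalityI subsetI)
    fix l assume "l \<in> {..<j}"
    then show "l \<in> (\<lambda>n. min n (j - 1)) ` {0..<card V}"
      using assms by (intro image_eqI[of _ _ l]) auto
  qed (use assms in auto)
  finally have "g \<in> surjections V j" using assms(2) by (auto simp: surjections_def g_def)
  then show ?thesis by blast
qed

lemma comp_surjections: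
  assumes "g \<in> surjections V m" "h \<in> surjections {..<m} j"
  shows "(\<lambda>i\<in>V. h (g i)) \<in> surjections V j"
proof -
  have "(\<lambda>i. h (g i)) ` V = h ` g ` V" by auto
  then show ?thesis using assms by (auto simp: surjections_def)
qed

lemma bij_betw_surjection_self:
  assumes "\<tau> \<in> surjections {..<j} j"
  shows "bij_betw \<tau> {..<j} {..<j}"
  using assms by (auto simp: surjections_def bij_betw_def intro!: eq_card_imp_inj_on)

lemma card_surjections_self: "card (surjections {..<j} j) = fact j"
proof -
  have "bij_betw (\<lambda>p. restrict p {..<j}) {p. p permutes {..<j}} (surjections {..<j} j)"
  proof (rule bij_betwI[where g = "\<lambda>\<tau> i. if i < j then \<tau> i else i"])
    show "(\<lambda>p. restrict p {..<j}) \<in> {p. p permutes {..<j}} \<rightarrow> surjections {..<j} j"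
    proof (rule funcsetI)
      fix p assume "p \<in> {p. p permutes {..<j}}"
      then have "p ` {..<j} = {..<j}" using permutes_image by blast
      then show "restrict p {..<j} \<in> surjections {..<j} j" by (auto simp: surjections_def)
    qed
    show "(\<lambda>\<tau> i. if i < j then \<tau> i else i) \<in> surjections {..<j} j \<rightarrow> {p. p permutes {..<j}}"
    proof (rule funcsetI, rule CollectI)
      fix \<tau> assume "\<tau> \<in> surjections {..<j} j"
      then have "bij_betw (\<lambda>i. if i < j then \<tau> i else i) {..<j} {..<j}"
        using bij_betw_surjection_self by (subst bij_betw_cong[of _ _ \<tau>]) auto
      then show "(\<lambda>i. if i < j then \<tau> i else i) permutes {..<j}"
        by (rule bij_imp_permutes) auto
    qed
  next
    fix p assume "p \<in> {p. p permutes {..<j}}"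
    then show "(\<lambda>i. if i < j then restrict p {..<j} i else i) = p"
      by (auto simp: permutes_def fun_eq_iff)
  next
    fix \<tau> assume "\<tau> \<in> surjections {..<j} j"
    then show "(\<lambda>i\<in>{..<j}. if i < j then \<tau> i else i) = \<tau>"
      by (auto simp: surjections_def fun_eq_iff PiE_iff extensional_def)
  qed
  then have "card {p. p permutes {..<j}} = card (surjections {..<j} j)" by (rule bij_betw_same_card)
  then show ?thesis using card_permutations[of "{..<j}" j] by simp
qed

lemma bij_betw_comp_surjections:
  assumes "finite V" "\<tau> \<in> surjections {..<j} j"
  shows "bij_betw (\<lambda>g. \<lambda>i\<in>V. \<tau> (g i)) (surjections V j) (surjections V j)"
proof -
  have "inj_on (\<lambda>g. \<lambda>i\<in>V. \<tau> (g i)) (surjections V j)"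
  proof (rule inj_onI)
    fix g g' assume g: "g \<in> surjections V j" "g' \<in> surjections V j"
      and eq: "(\<lambda>i\<in>V. \<tau> (g i)) = (\<lambda>i\<in>V. \<tau> (g' i))"
    show "g = g'"
    proof (rule extensionalityI[of _ V])
      fix i assume i: "i \<in> V"
      then have "\<tau> (g i) = \<tau> (g' i)" using eq by (metis restrict_apply')
      then show "g i = g' i"
        using bij_betw_surjection_self[OF assms(2)] surjections_lessD g i
        by (metis bij_betw_def inj_on_def lessThan_iff)
    qed (use g in \<open>auto simp: surjections_def PiE_iff\<close>)
  qed
  moreover have "(\<lambda>g. \<lambda>i\<in>V. \<tau> (g i)) ` surjections V j \<subseteq> surjections V j"
    using comp_surjections[OF _ assms(2)] by blast
  ultimately show ?thesis
    unfolding bij_betw_def using endo_inj_surj[OF finite_surjections[OF assms(1)]] by blast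
qed

text \<open>The blocks are the differences of consecutive members of the chain, completed by the
  empty set and \<open>V\<close>. Conversely, the block number of \<open>i\<close> is the number of
  members that avoid \<open>i\<close>.\<close>

lemma bij_betw_surjections_subset_chains:
  assumes fin: "finite V" and ne: "V \<noteq> {}" and j: "0 < j"
  shows "bij_betw (\<lambda>g. (\<lambda>l. {i \<in> V. g i < l}) ` {1..<j}) (surjections V j)
    {c \<in> subset_chains V. card c = j - 1}"
proof (rule bij_betwI[where g = "\<lambda>c. \<lambda>i\<in>V. card {A \<in> c. i \<notin> A}"])
  let ?f = "\<lambda>g l. {i \<in> V. g i < (l :: nat)}"
  have inj: "inj_on (?f g) {1..<j}" if g: "g \<in> surjections V j" for g
  proof (rule linorder_inj_onI)
    fix l l' assume l: "l < l'" "l \<in> {1..<j}"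
    then obtain i where "i \<in> V" "g i = l" using surjections_obtain[OF g, of l] by auto
    then have "i \<in> ?f g l'" "i \<notin> ?f g l" using l by auto
    then show "?f g l \<noteq> ?f g l'" by blast
  qed auto
  show "(\<lambda>g. ?f g ` {1..<j}) \<in> surjections V j \<rightarrow> {c \<in> subset_chains V. card c = j - 1}"
  proof (rule funcsetI, rule CollectI, rule conjI)
    fix g assume g: "g \<in> surjections V j"
    show "?f g ` {1..<j} \<in> subset_chains V"
      unfolding subset_chains_def mem_Collect_eq
    proof (intro conjI ballI subsetI)
      fix A assume "A \<in> ?f g ` {1..<j}"
      then obtain l where l: "1 \<le> l" "l < j" "A = ?f g l" by auto
      obtain i where "i \<in> V" "g i = l" using surjections_obtain[OF g l(2)] .
      moreover obtain i' where "i' \<in> V" "g i' = 0" using surjections_obtain[OF g j] .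
      ultimately have "i \<in> V - A" "i' \<in> A" using l by auto
      then show "A \<in> {A. A \<subset> V \<and> A \<noteq> {}}" using l by auto
    next
      fix A B assume "A \<in> ?f g ` {1..<j}" "B \<in> ?f g ` {1..<j}"
      then obtain l l' where "A = ?f g l" "B = ?f g l'" by auto
      then show "A \<subseteq> B \<or> B \<subseteq> A" by (cases l l' rule: le_cases) auto
    qed
    show "card (?f g ` {1..<j}) = j - 1" using card_image[OF inj[OF g]] by simp
  qed
  show "(\<lambda>i\<in>V. card {A \<in> ?f g ` {1..<j}. i \<notin> A}) = g" if g: "g \<in> surjections V j" for g
  proof (rule extensionalityI[of _ V])
    fix i assume i: "i \<in> V"
    then have "{A \<in> ?f g ` {1..<j}. i \<notin> A} = ?f g ` {1..g i}"
      using surjections_lessD[OF g i] by force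
    moreover have "inj_on (?f g) {1..g i}"
      using surjections_lessD[OF g i] by (intro inj_on_subset[OF inj[OF g]]) auto
    ultimately show "(\<lambda>i\<in>V. card {A \<in> ?f g ` {1..<j}. i \<notin> A}) i = g i"
      using i by (simp add: card_image)
  qed (use g in \<open>auto simp: surjections_def PiE_iff\<close>)
  let ?h = "\<lambda>c i. card {A \<in> c. i \<notin> A}"
  have *: "?f (\<lambda>i\<in>V. ?h c i) ` {1..<j} = c \<and> (\<lambda>i\<in>V. ?h c i) \<in> surjections V j"
    if c: "c \<in> {c \<in> subset_chains V. card c = j - 1}" for c
  proof -
    have card: "card c = j - 1" and cV: "\<And>A. A \<in> c \<Longrightarrow> A \<subset> V" "\<And>A. A \<in> c \<Longrightarrow> A \<noteq> {}"
      and ch: "\<And>A B. A \<in> c \<Longrightarrow> B \<in> c \<Longrightarrow> A \<subseteq> B \<or> B \<subseteq> A"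
      using c by (auto simp: subset_chains_def)
    have finc: "finite c" using c fin finite_subset_chain by blast
    \<comment> \<open>\<open>r\<close> is the rank of a member in the chain, and \<open>L l\<close>
      is the union of the first \<open>l\<close> blocks given by the avoidance counts. From
      \<open>L (r A) = A\<close> the ranks are distinct, and counting forces them to fill
      \<open>{1..<j}\<close>.\<close>
    define r where "r A = card {B \<in> c. B \<subseteq> A}" for A
    define L where "L l = {i \<in> V. ?h c i < l}" for l
    have L: "L (r A) = A" if A: "A \<in> c" for A
    proof -
      have "?h c i < r A" if "i \<in> A" for i
        unfolding r_def
      proof (rule psubset_card_mono)
        show "{B \<in> c. i \<notin> B} \<subset> {B \<in> c. B \<subseteq> A}"
        proof (rule psubsetI)
          show "{B \<in> c. i \<notin> B} \<subseteq> {B \<in> c. B \<subseteq> A}" using ch[OF A] that by blast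
          have "A \<in> {B \<in> c. B \<subseteq> A}" "A \<notin> {B \<in> c. i \<notin> B}" using A that by auto
          then show "{B \<in> c. i \<notin> B} \<noteq> {B \<in> c. B \<subseteq> A}" by blast
        qed
      qed (use finc in simp)
      moreover have "\<not> ?h c i < r A" if "i \<notin> A" for i
      proof -
        have "{B \<in> c. B \<subseteq> A} \<subseteq> {B \<in> c. i \<notin> B}" using that by blast
        then have "r A \<le> ?h c i" unfolding r_def using finc by (intro card_mono) auto
        then show ?thesis by simp
      qed
      ultimately show ?thesis using cV(1)[OF A] unfolding L_def by blast
    qed
    have "inj_on r c" by (rule inj_on_inverseI[of _ L]) (rule L)
    moreover have "r ` c \<subseteq> {1..<j}"
    proof (intro image_subsetI)
      fix A assume A: "A \<in> c"
      have "r A \<le> card c" unfolding r_def using finc by (intro card_mono) auto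
      moreover have "r A > 0" unfolding r_def using A finc by (subst card_gt_0_iff) auto
      ultimately show "r A \<in> {1..<j}" using card j by auto
    qed
    ultimately have rc: "r ` c = {1..<j}"
      using card by (intro card_subset_eq) (auto simp: card_image)
    have Lc: "L l \<in> c" "r (L l) = l" if "l \<in> {1..<j}" for l
      using that L unfolding rc[symmetric] by auto
    have hj: "?h c i < j" for i
    proof -
      have "?h c i \<le> card c" using finc by (intro card_mono) auto
      then show ?thesis using card j by simp
    qed
    have "(\<lambda>i\<in>V. ?h c i) \<in> surjections V j"
    proof -
      have "l \<in> ?h c ` V" if l: "l < j" for l
      proof -
        \<comment> \<open>The value \<open>l\<close> is attained exactly if consecutive levels
          differ. The end levels \<open>L 0 = {}\<close> and \<open>L j = V\<close> are not members
          of the chain and are treated separately.\<close>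
        have "L l \<noteq> L (Suc l)"
        proof (cases "l = 0")
          case True
          have "L (Suc l) \<noteq> {}"
          proof (cases "Suc l = j")
            case True
            then show ?thesis using hj ne by (auto simp: L_def)
          next
            case False
            then have "Suc l \<in> {1..<j}" using l by auto
            from Lc(1)[OF this] show ?thesis by (rule cV(2))
          qed
          moreover have "L l = {}" using True by (simp add: L_def)
          ultimately show ?thesis by simp
        next
          case False
          then have lj: "l \<in> {1..<j}" using l by auto
          show ?thesis
          proof (cases "Suc l = j")
            case True
            then have "L (Suc l) = V" using hj by (auto simp: L_def)
            moreover have "L l \<noteq> V" using cV(1)[OF Lc(1)[OF lj]] by blast
            ultimately show ?thesis by simp
          next
            case False
            then have "Suc l \<in> {1..<j}" using l by auto
            then show ?thesis using Lc(2)[of l] Lc(2)[of "Suc l"] lj by (metis n_not_Suc_n)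
          qed
        qed
        moreover have "L l \<subseteq> L (Suc l)" by (auto simp: L_def)
        ultimately obtain i where "i \<in> L (Suc l)" "i \<notin> L l" by blast
        then have "i \<in> V" "?h c i = l" by (auto simp: L_def)
        then show ?thesis by blast
      qed
      then show ?thesis using hj by (auto simp: surjections_def)
    qed
    moreover have "?f (\<lambda>i\<in>V. ?h c i) ` {1..<j} = c"
    proof -
      have "?f (\<lambda>i\<in>V. ?h c i) = L" by (auto simp: L_def fun_eq_iff)
      then have "?f (\<lambda>i\<in>V. ?h c i) ` {1..<j} = L ` r ` c" by (simp only: rc)
      also have "\<dots> = c" using L by (simp add: image_image)
      finally show ?thesis .
    qed
    ultimately show ?thesis by blast
  qed
  show "(\<lambda>c. \<lambda>i\<in>V. ?h c i) \<in> {c \<in> subset_chains V. card c = j - 1} \<rightarrow> surjections V j"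
    using * by blast
  show "\<And>c. c \<in> {c \<in> subset_chains V. card c = j - 1} \<Longrightarrow> ?f (\<lambda>i\<in>V. ?h c i) ` {1..<j} = c"
    using * by blast
qed

text \<open>
  A surjection \<open>g\<close> onto \<open>{..<j}\<close> encodes an ordered partition of \<open>V\<close> into \<open>j\<close> blocks; the sums
  over \<open>{i \<in> V. g i < l}\<close> for \<open>0 < l < j\<close> are the proper partial sums of the block sums.
\<close>

definition positive_levels :: "'i set \<Rightarrow> ('i \<Rightarrow> 'e::real_inner) \<Rightarrow> ('i \<Rightarrow> nat) \<Rightarrow> nat \<Rightarrow> bool" where
  "positive_levels V b g j \<longleftrightarrow> (\<exists>y. \<forall>l\<in>{1..<j}. (\<Sum>i | i \<in> V \<and> g i < l. b i) \<bullet> y > 0)"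

lemma euler_relation_surjections:
  fixes b :: "'i \<Rightarrow> 'e::euclidean_space"
  assumes fin: "finite V" and ne: "V \<noteq> {}" and sum0: "(\<Sum>i\<in>V. b i) = 0"
    and total: "\<And>y. (\<forall>i\<in>V. b i \<bullet> y = 0) \<Longrightarrow> y = 0"
  shows "(\<Sum>j\<in>{1..card V}. (-1) ^ (j - 1) * (\<Sum>g\<in>surjections V j. of_bool (positive_levels V b g j))) =
    ((-1) ^ DIM('e) :: int)"
proof -
  let ?F = "\<lambda>c. of_bool (\<exists>y. \<forall>A\<in>c. (\<Sum>i\<in>A. b i) \<bullet> y > 0) :: int"
  have img: "(\<lambda>c. Suc (card c)) ` subset_chains V \<subseteq> {1..card V}"
  proof (intro image_subsetI)
    fix c assume c: "c \<in> subset_chains V"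
    have "bij_betw (\<lambda>g. (\<lambda>l. {i \<in> V. g i < l}) ` {1..<Suc (card c)}) (surjections V (Suc (card c)))
        {c' \<in> subset_chains V. card c' = Suc (card c) - 1}"
      by (rule bij_betw_surjections_subset_chains) (use fin ne in auto)
    moreover have "c \<in> {c' \<in> subset_chains V. card c' = Suc (card c) - 1}" using c by simp
    ultimately have "surjections V (Suc (card c)) \<noteq> {}" unfolding bij_betw_def by blast
    then show "Suc (card c) \<in> {1..card V}" using surjections_le_card[OF fin, of _ "Suc (card c)"] by auto
  qed
  have "(-1) ^ DIM('e) = (\<Sum>c\<in>subset_chains V. (-1) ^ card c * ?F c)"
    using euler_relation_chains[OF fin sum0 total] by simp
  also have "\<dots> = (\<Sum>j\<in>{1..card V}. \<Sum>c | c \<in> subset_chains V \<and> Suc (card c) = j. (-1) ^ card c * ?F c)"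
    by (rule sum.group[symmetric]) (use fin finite_subset_chains img in auto)
  also have "\<dots> = (\<Sum>j\<in>{1..card V}. (-1) ^ (j - 1) * (\<Sum>g\<in>surjections V j. of_bool (positive_levels V b g j)))"
  proof (rule sum.cong[OF refl])
    fix j assume j: "j \<in> {1..card V}"
    have "(\<Sum>c | c \<in> subset_chains V \<and> Suc (card c) = j. (-1) ^ card c * ?F c) =
        (\<Sum>c | c \<in> subset_chains V \<and> card c = j - 1. (-1) ^ (j - 1) * ?F c)"
      using j by (intro sum.cong) auto
    also have "\<dots> = (\<Sum>g\<in>surjections V j. (-1) ^ (j - 1) * ?F ((\<lambda>l. {i \<in> V. g i < l}) ` {1..<j}))"
      by (rule sum.reindex_bij_betw[symmetric], rule bij_betw_surjections_subset_chains)
         (use fin ne j in auto)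
    also have "\<dots> = (-1) ^ (j - 1) * (\<Sum>g\<in>surjections V j. of_bool (positive_levels V b g j))"
      by (simp add: sum_distrib_left positive_levels_def)
    finally show "(\<Sum>c | c \<in> subset_chains V \<and> Suc (card c) = j. (-1) ^ card c * ?F c) =
      (-1) ^ (j - 1) * (\<Sum>g\<in>surjections V j. of_bool (positive_levels V b g j))" .
  qed
  finally show ?thesis by simp
qed

section \<open>Block sums and symmetrisation over the order of the blocks\<close>

definition block_sum :: "'i set \<Rightarrow> ('i \<Rightarrow> 'e::comm_monoid_add) \<Rightarrow> ('i \<Rightarrow> nat) \<Rightarrow> nat \<Rightarrow> 'e" where
  "block_sum V b g l = (\<Sum>i | i \<in> V \<and> g i = l. b i)"

lemma sum_block_sum:
  assumes "finite V" "g \<in> surjections V m"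
  shows "(\<Sum>l | l \<in> {..<m} \<and> P l. block_sum V b g l) = (\<Sum>i | i \<in> V \<and> P (g i). b i)"
proof -
  have "(\<Sum>l | l \<in> {..<m} \<and> P l. block_sum V b g l) =
      (\<Sum>l\<in>{l \<in> {..<m}. P l}. \<Sum>i\<in>{i \<in> {i \<in> V. P (g i)}. g i = l}. b i)"
    unfolding block_sum_def by (intro sum.cong) auto
  also have "\<dots> = (\<Sum>i\<in>{i \<in> V. P (g i)}. b i)"
    by (rule sum.group) (use assms surjections_lessD[OF assms(2)] in auto)
  finally show ?thesis .
qed

text \<open>Partial sums along a merged or reordered partition are partial sums of the block sums,
  so a question about \<open>V\<close> becomes one about \<open>{..<m}\<close>.\<close>

lemma levels_comp_surjection:
  assumes "finite V" "g \<in> surjections V m"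
  shows "(\<Sum>i | i \<in> V \<and> (\<lambda>i\<in>V. h (g i)) i < l. b i) =
    (\<Sum>k | k \<in> {..<m} \<and> h k < l. block_sum V b g k)"
  unfolding sum_block_sum[OF assms] by (intro sum.cong) auto

text \<open>By separation, this counts the orders of the \<open>m\<close> vectors for which 0 lies
  outside the hull of the proper partial sums; \<open>\<tau> i\<close> is the position of
  \<open>b i\<close>.\<close>

definition positive_orders :: "nat \<Rightarrow> (nat \<Rightarrow> 'e::real_inner) \<Rightarrow> nat" where
  "positive_orders m b = card {\<tau> \<in> surjections {..<m} m. positive_levels {..<m} b \<tau> m}"

lemma sum_of_bool_positive_levels:
  "(\<Sum>\<tau>\<in>surjections {..<m} m. of_bool (positive_levels {..<m} b \<tau> m)) = of_nat (positive_orders m b)"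
proof -
  have "surjections {..<m} m \<inter> {\<tau>. positive_levels {..<m} b \<tau> m} =
    {\<tau> \<in> surjections {..<m} m. positive_levels {..<m} b \<tau> m}" by auto
  then show ?thesis
    unfolding positive_orders_def by (simp add: sum_of_bool_eq finite_surjections)
qed

text \<open>For fixed \<open>g\<close>, the sum over the relabellings of its blocks counts the
  positive orders of the block sums. For a fixed relabelling, composition permutes the ordered
  partitions and leaves the sum over \<open>g\<close> unchanged; there are \<open>fact j\<close>
  relabellings.\<close>

lemma sum_positive_levels_symmetrise:
  assumes "finite V"
  shows "fact j * (\<Sum>g\<in>surjections V j. of_bool (positive_levels V b g j)) =
    (\<Sum>g\<in>surjections V j. of_nat (positive_orders j (block_sum V b g)) :: 'a::{comm_semiring_1, semiring_char_0})"
proof -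
  have "(\<Sum>g\<in>surjections V j. of_nat (positive_orders j (block_sum V b g)) :: 'a) =
      (\<Sum>g\<in>surjections V j. \<Sum>\<tau>\<in>surjections {..<j} j.
        of_bool (positive_levels V b (\<lambda>i\<in>V. \<tau> (g i)) j))"
    unfolding sum_of_bool_positive_levels[symmetric]
    by (intro sum.cong refl) (simp only: positive_levels_def levels_comp_surjection[OF assms])
  also have "\<dots> = (\<Sum>\<tau>\<in>surjections {..<j} j. \<Sum>g\<in>surjections V j.
        of_bool (positive_levels V b (\<lambda>i\<in>V. \<tau> (g i)) j))"
    by (rule sum.swap)
  also have "\<dots> = (\<Sum>\<tau>\<in>surjections {..<j} j. \<Sum>g\<in>surjections V j. of_bool (positive_levels V b g j))"
    by (intro sum.cong refl sum.reindex_bij_betw[OF bij_betw_comp_surjections[OF assms]])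
  also have "\<dots> = fact j * (\<Sum>g\<in>surjections V j. of_bool (positive_levels V b g j))"
    by (simp add: card_surjections_self)
  finally show ?thesis by simp
qed

section \<open>Counting positive orders\<close>

lemma card_surjections_image:
  assumes "finite V" "finite B"
  shows "card {g \<in> V \<rightarrow>\<^sub>E X. g ` V = B} = (if B \<subseteq> X then card (surjections V (card B)) else 0)"
proof (cases "B \<subseteq> X")
  case False
  then have "{g \<in> V \<rightarrow>\<^sub>E X. g ` V = B} = {}" by blast
  then show ?thesis using False by (simp only: card.empty if_False)
next
  case True
  obtain e where e: "bij_betw e {..<card B} B"
    using ex_bij_betw_nat_finite[OF assms(2)] by (auto simp: lessThan_atLeast0)
  let ?e = "the_inv_into {..<card B} e"
  have e': "?e (e l) = l" if "l < card B" for l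
    using e that by (simp add: bij_betw_def the_inv_into_f_f)
  have e'': "e (?e x) = x" "?e x < card B" if "x \<in> B" for x
    using f_the_inv_into_f_bij_betw[OF e] that bij_betwE[OF bij_betw_the_inv_into[OF e]] by auto
  have "bij_betw (\<lambda>g. \<lambda>i\<in>V. e (g i)) (surjections V (card B)) {g \<in> V \<rightarrow>\<^sub>E X. g ` V = B}"
  proof (rule bij_betwI[where g = "\<lambda>g. \<lambda>i\<in>V. ?e (g i)"])
    show "(\<lambda>g. \<lambda>i\<in>V. e (g i)) \<in> surjections V (card B) \<rightarrow> {g \<in> V \<rightarrow>\<^sub>E X. g ` V = B}"
    proof (rule funcsetI)
      fix g assume g: "g \<in> surjections V (card B)"
      have "(\<lambda>i\<in>V. e (g i)) ` V = e ` g ` V" by auto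
      also have "\<dots> = B" using g e by (simp add: surjections_def bij_betw_def)
      finally have "(\<lambda>i\<in>V. e (g i)) ` V = B" .
      then show "(\<lambda>i\<in>V. e (g i)) \<in> {g \<in> V \<rightarrow>\<^sub>E X. g ` V = B}"
        using True by (auto simp: PiE_iff)
    qed
    show "(\<lambda>g. \<lambda>i\<in>V. ?e (g i)) \<in> {g \<in> V \<rightarrow>\<^sub>E X. g ` V = B} \<rightarrow> surjections V (card B)"
    proof (rule funcsetI)
      fix g assume g: "g \<in> {g \<in> V \<rightarrow>\<^sub>E X. g ` V = B}"
      have "(\<lambda>i\<in>V. ?e (g i)) ` V = ?e ` g ` V" by auto
      also have "\<dots> = {..<card B}"
        using g bij_betw_the_inv_into[OF e] by (simp add: bij_betw_def)
      finally show "(\<lambda>i\<in>V. ?e (g i)) \<in> surjections V (card B)" by (auto simp: surjections_def)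
    qed
  next
    fix g assume g: "g \<in> surjections V (card B)"
    show "(\<lambda>i\<in>V. ?e ((\<lambda>i\<in>V. e (g i)) i)) = g"
      by (rule extensionalityI[of _ V])
         (use g surjections_lessD[OF g] in \<open>auto simp: e' surjections_def PiE_iff\<close>)
  next
    fix g assume g: "g \<in> {g \<in> V \<rightarrow>\<^sub>E X. g ` V = B}"
    then have "\<And>i. i \<in> V \<Longrightarrow> g i \<in> B" by auto
    with g show "(\<lambda>i\<in>V. e ((\<lambda>i\<in>V. ?e (g i)) i)) = g"
      by (intro extensionalityI[of _ V]) (auto simp: e'' PiE_iff)
  qed
  then show ?thesis using True bij_betw_same_card by fastforce
qed

text \<open>The \<open>x ^ m\<close> functions are sorted by their images: an image of size
  \<open>j\<close> can be chosen in \<open>x choose j\<close> ways, and each is hit by the same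
  number of surjections.\<close>

lemma power_eq_sum_surjections:
  "x ^ m = (\<Sum>j\<le>m. (x choose j) * card (surjections {..<m} j))"
proof -
  let ?V = "{..<m}" and ?X = "{..<x}"
  have "x ^ m = card (?V \<rightarrow>\<^sub>E ?X)" by (simp add: card_PiE)
  also have "\<dots> = (\<Sum>B\<in>Pow ?X. \<Sum>g | g \<in> ?V \<rightarrow>\<^sub>E ?X \<and> g ` ?V = B. 1)"
    unfolding card_eq_sum by (rule sum.group[symmetric]) (auto intro!: finite_PiE)
  also have "\<dots> = (\<Sum>B\<in>Pow ?X. card (surjections ?V (card B)))"
    by (intro sum.cong refl, simp only: card_eq_sum[symmetric], subst card_surjections_image)
       (auto intro: finite_subset)
  also have "\<dots> = (\<Sum>j\<le>x. \<Sum>B | B \<in> Pow ?X \<and> card B = j. card (surjections ?V (card B)))"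
    by (rule sum.group[symmetric]) (auto dest: subset_eq_atLeast0_lessThan_card card_mono[rotated])
  also have "\<dots> = (\<Sum>j\<le>x. (x choose j) * card (surjections ?V j))"
  proof (rule sum.cong[OF refl])
    fix j
    have "(\<Sum>B | B \<in> Pow ?X \<and> card B = j. card (surjections ?V (card B))) =
        (\<Sum>B | B \<subseteq> ?X \<and> card B = j. card (surjections ?V j))"
      by (intro sum.cong) auto
    then show "(\<Sum>B | B \<in> Pow ?X \<and> card B = j. card (surjections ?V (card B))) =
        (x choose j) * card (surjections ?V j)"
      by (simp add: n_subsets)
  qed
  also have "\<dots> = (\<Sum>j\<le>max x m. (x choose j) * card (surjections ?V j))"
    by (rule sum.mono_neutral_left) auto
  also have "\<dots> = (\<Sum>j\<le>m. (x choose j) * card (surjections ?V j))"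
  proof (rule sum.mono_neutral_right)
    show "\<forall>j\<in>{..max x m} - {..m}. (x choose j) * card (surjections ?V j) = 0"
    proof
      fix j assume "j \<in> {..max x m} - {..m}"
      then have "surjections ?V j = {}" using surjections_le_card[of ?V _ j] by fastforce
      then show "(x choose j) * card (surjections ?V j) = 0" by simp
    qed
  qed auto
  finally show ?thesis .
qed

text \<open>In the variable \<open>t = - x\<close>, the expansion of \<open>x ^ m\<close> in
  binomial coefficients becomes one of \<open>(- t) ^ m\<close> in rising factorials. The two
  polynomials agree at infinitely many points, hence are equal, and \<open>(- t) ^ m\<close> has no
  term in \<open>t ^ i\<close> for \<open>i < m\<close>.\<close>

lemma surjections_stirling_orthogonal:
  assumes "i < m"
  shows "(\<Sum>j\<le>m. (-1) ^ j * real (card (surjections {..<m} j)) / fact j * real (stirling j i)) = 0"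
proof -
  define w where "w j = (-1) ^ j * real (card (surjections {..<m} j)) / fact j" for j
  define P where "P = (\<Sum>j\<le>m. \<Sum>k\<le>j. monom (w j * real (stirling j k)) k)"
  have ev: "poly P (- real x) = poly (monom ((-1) ^ m) m) (- real x)" for x
  proof -
    have "poly P (- real x) = (\<Sum>j\<le>m. w j * (\<Sum>k\<le>j. real (stirling j k) * (- real x) ^ k))"
      by (simp add: P_def poly_sum poly_monom sum_distrib_left mult.assoc)
    also have "\<dots> = (\<Sum>j\<le>m. w j * pochhammer (- real x) j)"
      by (simp only: stirling_pochhammer)
    also have "\<dots> = (\<Sum>j\<le>m. real ((x choose j) * card (surjections {..<m} j)))"
    proof (rule sum.cong[OF refl])
      fix j
      have "real (x choose j) = (-1) ^ j * pochhammer (- real x) j / fact j"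
        by (simp add: binomial_gbinomial gbinomial_pochhammer)
      then show "w j * pochhammer (- real x) j = real ((x choose j) * card (surjections {..<m} j))"
        by (simp add: w_def)
    qed
    also have "\<dots> = real (x ^ m)" unfolding power_eq_sum_surjections[of x m] by simp
    also have "\<dots> = poly (monom ((-1) ^ m) m) (- real x)"
      by (simp add: poly_monom flip: power_mult_distrib)
    finally show ?thesis .
  qed
  have "P = monom ((-1) ^ m) m"
  proof (rule ccontr)
    assume "P \<noteq> monom ((-1) ^ m) m"
    then have "finite {y. poly (P - monom ((-1) ^ m) m) y = 0}"
      by (intro poly_roots_finite) simp
    moreover have "range (\<lambda>x. - real x) \<subseteq> {y. poly (P - monom ((-1) ^ m) m) y = 0}"
      using ev by auto
    ultimately have "finite (range (\<lambda>x::nat. - real x))" using finite_subset by blast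
    then show False using finite_imageD[of "\<lambda>x. - real x" "UNIV :: nat set"] by (simp add: inj_on_def)
  qed
  then have "coeff P i = 0" using assms by simp
  moreover have "coeff P i = (\<Sum>j\<le>m. w j * real (stirling j i))"
  proof -
    have "(\<Sum>k\<le>j. coeff (monom (w j * real (stirling j k)) k) i) = w j * real (stirling j i)" for j
      by (cases "i \<le> j") (auto simp: sum.delta' not_le)
    then show ?thesis by (simp add: P_def coeff_sum)
  qed
  ultimately show ?thesis by (simp add: w_def)
qed

text \<open>Twice the bracket sum of the theorem: for \<open>m \<ge> 2\<close> it will be the number
  of positive orders of \<open>m\<close> generic vectors with sum zero. The bound
  \<open>d div 2\<close> keeps the subtraction from truncating.\<close>

definition stirling_parity_sum :: "nat \<Rightarrow> nat \<Rightarrow> real" where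
  "stirling_parity_sum d m = 2 * (\<Sum>r = 0..d div 2. real (stirling m (d - 2 * r)))"

text \<open>The weight is 2 on the indices with the parity of \<open>d\<close> and 0 on the others,
  so identities linear in the Stirling numbers carry over to the bracket sum.\<close>

lemma stirling_parity_sum_parity:
  "stirling_parity_sum d m = (\<Sum>i\<le>d. (1 + (-1) ^ (d + i)) * real (stirling m i))"
proof -
  have "(\<Sum>i\<le>d. (1 + (-1) ^ (d + i)) * real (stirling m i)) =
      (\<Sum>i | i \<le> d \<and> even (d + i). 2 * real (stirling m i))"
    by (intro sum.mono_neutral_cong_right) auto
  also have "\<dots> = (\<Sum>r = 0..d div 2. 2 * real (stirling m (d - 2 * r)))"
  proof (rule sum.reindex_bij_witness[where i = "\<lambda>r. d - 2 * r" and j = "\<lambda>i. (d - i) div 2"], unfold mem_Collect_eq)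
    show *: "d - 2 * ((d - i) div 2) = i" if "i \<le> d \<and> even (d + i)" for i
      using that by presburger
    then show "2 * real (stirling m (d - 2 * ((d - i) div 2))) = 2 * real (stirling m i)"
      if "i \<le> d \<and> even (d + i)" for i
      using that by simp
  next
    fix r assume r: "r \<in> {0..d div 2}"
    then have "2 * r \<le> d" by auto
    then show "(d - (d - 2 * r)) div 2 = r" "d - 2 * r \<le> d \<and> even (d + (d - 2 * r))" by auto
  qed auto
  finally show ?thesis by (simp add: stirling_parity_sum_def sum_distrib_left)
qed

text \<open>The weights turn the sum into values of the rising factorial at \<open>1\<close> and
  \<open>-1\<close>; the second contains the factor 0 once \<open>m \<ge> 2\<close>.\<close>

lemma stirling_parity_sum_eq_fact:
  assumes "2 \<le> m" "m \<le> d + 1"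
  shows "stirling_parity_sum d m = fact m"
proof -
  have "stirling_parity_sum d m = (\<Sum>i\<le>m. (1 + (-1) ^ (d + i)) * real (stirling m i))"
    unfolding stirling_parity_sum_parity
  proof (rule sum.mono_neutral_cong)
    show "\<And>i. i \<in> {..m} - {..d} \<Longrightarrow> (1 + (-1) ^ (d + i)) * real (stirling m i) = 0"
    proof -
      fix i assume "i \<in> {..m} - {..d}"
      \<comment> \<open>The one extra index has the wrong parity, so its weight is 0.\<close>
      then have "i = d + 1" using assms by auto
      then show "(1 + (-1) ^ (d + i)) * real (stirling m i) = 0" by simp
    qed
  qed auto
  also have "\<dots> = (\<Sum>i\<le>m. real (stirling m i) * 1 ^ i) + (-1) ^ d * (\<Sum>i\<le>m. real (stirling m i) * (-1) ^ i)"
    by (simp add: sum_distrib_left algebra_simps power_add sum.distrib)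
  also have "\<dots> = pochhammer 1 m + (-1) ^ d * pochhammer (-1) m"
    by (simp only: stirling_pochhammer)
  also have "pochhammer (-1 :: real) m = 0"
    using assms(1) pochhammer_of_nat_eq_0_iff[of 1 m, where 'a = real] by simp
  finally show ?thesis by (simp add: pochhammer_fact)
qed

lemma stirling_parity_sum_orthogonal:
  assumes "d < m"
  shows "(\<Sum>j\<le>m. (-1) ^ j * real (card (surjections {..<m} j)) / fact j * stirling_parity_sum d j) = 0"
proof -
  have "(\<Sum>j\<le>m. (-1) ^ j * real (card (surjections {..<m} j)) / fact j * stirling_parity_sum d j) =
     (\<Sum>i\<le>d. (1 + (-1) ^ (d + i)) *
       (\<Sum>j\<le>m. (-1) ^ j * real (card (surjections {..<m} j)) / fact j * real (stirling j i)))"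
    unfolding stirling_parity_sum_parity sum_distrib_left
    by (subst sum.swap) (simp add: mult_ac)
  also have "\<dots> = 0"
    using assms by (intro sum.neutral ballI, subst surjections_stirling_orthogonal) auto
  finally show ?thesis .
qed

text \<open>A single vector has one positive order, so the formula misses this count by
  \<open>(-1) ^ d\<close>. This is also the right-hand side of the Euler relation, and the two
  cancel in \<open>positive_orders_eq\<close>.\<close>

lemma stirling_parity_sum_1: "stirling_parity_sum d 1 = 1 - (-1) ^ d"
proof (cases "d = 0")
  case False
  have "stirling_parity_sum d 1 = (\<Sum>i\<in>{1}. (1 + (-1) ^ (d + i)) * real (stirling 1 i))"
    unfolding stirling_parity_sum_parity
  proof (rule sum.mono_neutral_right)
    show "\<forall>i\<in>{..d} - {1}. (1 + (-1) ^ (d + i)) * real (stirling 1 i) = 0"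
    proof
      fix i assume "i \<in> {..d} - {1}"
      then have "i = 0 \<or> 1 < i" by auto
      then show "(1 + (-1) ^ (d + i)) * real (stirling 1 i) = 0" by auto
    qed
  qed (use False in auto)
  then show ?thesis by simp
qed (simp add: stirling_parity_sum_def)

text \<open>Linear independence of the partial sums, in dual form.\<close>

definition interpolating_levels :: "'i set \<Rightarrow> ('i \<Rightarrow> 'e::real_inner) \<Rightarrow> ('i \<Rightarrow> nat) \<Rightarrow> nat \<Rightarrow> bool" where
  "interpolating_levels V b g j \<longleftrightarrow>
     (\<forall>h :: nat \<Rightarrow> real. \<exists>y. \<forall>l\<in>{1..<j}. (\<Sum>i | i \<in> V \<and> g i < l. b i) \<bullet> y = h l)"

text \<open>At most \<open>DIM('e)\<close> vectors can be independent, hence the bound on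
  \<open>j\<close>. Asking for all ordered partitions, not only for one order of the steps, makes
  the property stable under merging.\<close>

definition generic_steps :: "'i set \<Rightarrow> ('i \<Rightarrow> 'e::euclidean_space) \<Rightarrow> bool" where
  "generic_steps V b \<longleftrightarrow>
     (\<forall>j \<le> DIM('e) + 1. \<forall>g\<in>surjections V j. interpolating_levels V b g j)"

lemma generic_stepsD:
  fixes b :: "'i \<Rightarrow> 'e::euclidean_space" and h :: "nat \<Rightarrow> real"
  assumes "generic_steps V b" "j \<le> DIM('e) + 1" "g \<in> surjections V j"
  shows "\<exists>y. \<forall>l\<in>{1..<j}. (\<Sum>i | i \<in> V \<and> g i < l. b i) \<bullet> y = h l"
  using assms unfolding generic_steps_def interpolating_levels_def by (elim allE impE ballE) auto

lemma generic_steps_block_sum: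
  fixes b :: "'i \<Rightarrow> 'e::euclidean_space"
  assumes "finite V" "generic_steps V b" "g \<in> surjections V m"
  shows "generic_steps {..<m} (block_sum V b g)"
  unfolding generic_steps_def interpolating_levels_def
proof (intro allI impI ballI)
  fix j h' and h :: "nat \<Rightarrow> real"
  assume j: "j \<le> DIM('e) + 1" and h': "h' \<in> surjections {..<m} j"
  show "\<exists>y. \<forall>l\<in>{1..<j}. (\<Sum>k | k \<in> {..<m} \<and> h' k < l. block_sum V b g k) \<bullet> y = h l"
    unfolding levels_comp_surjection[OF assms(1,3), symmetric]
    by (rule generic_stepsD[OF assms(2) j comp_surjections[OF assms(3) h']])
qed

text \<open>A partition into \<open>DIM('e) + 1\<close> blocks has \<open>DIM('e)\<close>
  independent partial sums. They span the space, and \<open>y0\<close> is orthogonal to all of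
  them.\<close>

lemma generic_steps_total:
  fixes b :: "'i \<Rightarrow> 'e::euclidean_space"
  assumes fin: "finite V" and gen: "generic_steps V b" and card: "card V \<ge> DIM('e) + 1"
    and y0: "\<forall>i\<in>V. b i \<bullet> y0 = 0"
  shows "y0 = 0"
proof -
  obtain g where g: "g \<in> surjections V (DIM('e) + 1)"
    using surjections_nonempty[OF fin _ card] by auto
  define T where "T l = (\<Sum>i | i \<in> V \<and> g i < l. b i)" for l
  let ?D = "{1..<DIM('e) + 1}"
  have ex: "\<exists>y. \<forall>l\<in>?D. T l \<bullet> y = h l" for h :: "nat \<Rightarrow> real"
    unfolding T_def by (rule generic_stepsD[OF gen _ g]) simp
  have inj: "inj_on T ?D"
  proof (rule inj_onI)
    fix l l' assume l: "l \<in> ?D" "l' \<in> ?D" "T l = T l'"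
    obtain y where y: "\<forall>k\<in>?D. T k \<bullet> y = (if k = l then 1 else 0)"
      using ex[of "\<lambda>k. if k = l then 1 else 0"] ..
    have "T l \<bullet> y = 1" using y[rule_format, OF l(1)] by (simp only: simp_thms if_True)
    moreover have "T l' \<bullet> y = 0" if "l' \<noteq> l"
      using y[rule_format, OF l(2)] by (simp only: that simp_thms if_False)
    ultimately show "l = l'" using l(3) by (metis zero_neq_one)
  qed
  have "independent (T ` ?D)"
  proof (rule independent_if_scalars_zero)
    fix u v assume sum: "(\<Sum>x\<in>T ` ?D. u x *\<^sub>R x) = 0" and v: "v \<in> T ` ?D"
    \<comment> \<open>Pairing a vanishing combination with a vector that interpolates its own
      coefficients turns it into a sum of squares.\<close>
    obtain y where "\<forall>l\<in>?D. T l \<bullet> y = u (T l)" using ex[of "\<lambda>l. u (T l)"] by blast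
    then have y: "x \<bullet> y = u x" if "x \<in> T ` ?D" for x using that by blast
    have "(\<Sum>x\<in>T ` ?D. u x * u x) = (\<Sum>x\<in>T ` ?D. u x *\<^sub>R x) \<bullet> y"
      by (simp add: inner_sum_left y)
    also have "\<dots> = 0" using sum by simp
    finally show "u v = 0" using v by (subst (asm) sum_nonneg_eq_0_iff) auto
  qed simp
  moreover have "card (T ` ?D) = DIM('e)" using card_image[OF inj] by (simp del: One_nat_def)
  ultimately have "UNIV \<subseteq> span (T ` ?D)" by (intro card_ge_dim_independent) auto
  then have "y0 \<in> span (T ` ?D)" by blast
  moreover have "orthogonal y0 x" if "x \<in> T ` ?D" for x
    using that y0 by (auto simp: T_def orthogonal_def inner_commute[of y0] inner_sum_left)
  ultimately have "orthogonal y0 y0" by (rule orthogonal_to_span)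
  then show ?thesis by (simp add: orthogonal_self)
qed

text \<open>Strong induction on \<open>m\<close>. Up to \<open>DIM('e) + 1\<close> vectors, every
  order is positive. Beyond that, the symmetrised Euler relation expresses the term
  \<open>j = m\<close> through those with fewer blocks, and the parity sum satisfies the same
  relation by orthogonality.\<close>

lemma positive_orders_eq:
  fixes b :: "nat \<Rightarrow> 'e::euclidean_space"
  assumes "1 \<le> m" "(\<Sum>i<m. b i) = 0" "generic_steps {..<m} b"
  shows "real (positive_orders m b) = (if m = 1 then 1 else stirling_parity_sum DIM('e) m)"
  using assms
proof (induction m arbitrary: b rule: less_induct)
  case (less m)
  let ?d = "DIM('e)" and ?s = "\<lambda>j. real (card (surjections {..<m} j)) / fact j"
  show ?case
  proof (cases "m \<le> ?d + 1")
    case True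
    have "positive_levels {..<m} b \<tau> m" if "\<tau> \<in> surjections {..<m} m" for \<tau>
    proof -
      have "\<exists>y. \<forall>l\<in>{1..<m}. (\<Sum>i | i \<in> {..<m} \<and> \<tau> i < l. b i) \<bullet> y = 1"
        using generic_stepsD[OF less.prems(3) True that] .
      then obtain y where "\<forall>l\<in>{1..<m}. (\<Sum>i | i \<in> {..<m} \<and> \<tau> i < l. b i) \<bullet> y = 1" ..
      then show ?thesis unfolding positive_levels_def by (intro exI[of _ y]) simp
    qed
    then have "{\<tau> \<in> surjections {..<m} m. positive_levels {..<m} b \<tau> m} = surjections {..<m} m" by blast
    then have "real (positive_orders m b) = fact m" by (simp add: positive_orders_def card_surjections_self)
    then show ?thesis using True less.prems(1) by (auto simp: stirling_parity_sum_eq_fact)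
  next
    case False
    then have m: "m \<ge> ?d + 2" by simp
    let ?N = "\<lambda>j. \<Sum>g\<in>surjections {..<m} j. of_bool (positive_levels {..<m} b g j) :: real"
    \<comment> \<open>The extra summand at \<open>j = 1\<close> is the difference between the count
      1 and \<open>stirling_parity_sum ?d 1\<close>, so one formula covers all
      \<open>j\<close>.\<close>
    have N: "?N j = ?s j * (stirling_parity_sum ?d j + (if j = 1 then (-1) ^ ?d else 0))" if j: "j \<in> {1..<m}" for j
    proof -
      have "fact j * ?N j = (\<Sum>g\<in>surjections {..<m} j. real (positive_orders j (block_sum {..<m} b g)))"
        by (rule sum_positive_levels_symmetrise) simp
      also have "\<dots> = (\<Sum>g\<in>surjections {..<m} j. stirling_parity_sum ?d j + (if j = 1 then (-1) ^ ?d else 0))"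
      proof (rule sum.cong[OF refl])
        fix g assume g: "g \<in> surjections {..<m} j"
        have "(\<Sum>i<j. block_sum {..<m} b g i) = 0"
          using sum_block_sum[of "{..<m}" g j b "\<lambda>_. True"] g less.prems(2) by (simp add: lessThan_def)
        then have "real (positive_orders j (block_sum {..<m} b g)) = (if j = 1 then 1 else stirling_parity_sum ?d j)"
          using j g less.prems(3) by (intro less.IH generic_steps_block_sum) auto
        then show "real (positive_orders j (block_sum {..<m} b g)) =
            stirling_parity_sum ?d j + (if j = 1 then (-1) ^ ?d else 0)"
          using stirling_parity_sum_1[of ?d] by auto
      qed
      finally show ?thesis by (simp add: field_simps)
    qed
    have "(\<Sum>j\<in>{1..card {..<m}}. (-1) ^ (j - 1) *
        (\<Sum>g\<in>surjections {..<m} j. of_bool (positive_levels {..<m} b g j))) = ((-1) ^ ?d :: int)"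
    proof (rule euler_relation_surjections)
      show "{..<m} \<noteq> {}" using less.prems(1) by (auto simp: lessThan_empty_iff)
      show "y = 0" if "\<forall>i\<in>{..<m}. b i \<bullet> y = 0" for y
        using generic_steps_total[OF _ less.prems(3) _ that] m by simp
    qed (use less.prems in auto)
    then have "real_of_int (\<Sum>j\<in>{1..m}. (-1) ^ (j - 1) *
        (\<Sum>g\<in>surjections {..<m} j. of_bool (positive_levels {..<m} b g j))) = real_of_int ((-1) ^ ?d)"
      by (simp only: card_lessThan)
    then have "(\<Sum>j\<in>{1..m}. (-1) ^ (j - 1) * ?N j) = (-1) ^ ?d"
      by (simp only: of_int_sum of_int_mult of_int_power of_int_minus of_int_1 of_int_of_bool)
    moreover have "{1..m} = insert m {1..<m}" using less.prems(1) by auto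
    ultimately have "(-1) ^ (m - 1) * ?N m + (\<Sum>j\<in>{1..<m}. (-1) ^ (j - 1) * ?N j) = (-1) ^ ?d"
      by simp
    also have "?N m = real (positive_orders m b)" by (rule sum_of_bool_positive_levels)
    \<comment> \<open>Only one map goes onto a single block, so the correction contributes exactly
      \<open>(-1) ^ ?d\<close> and cancels the right-hand side.\<close>
    also have "(\<Sum>j\<in>{1..<m}. (-1) ^ (j - 1) * ?N j) =
        (\<Sum>j\<in>{1..<m}. (-1) ^ (j - 1) * ?s j * stirling_parity_sum ?d j) + (-1) ^ ?d"
    proof -
      have ne: "{..<m} \<noteq> {}" using m by (simp add: lessThan_empty_iff)
      have "surjections {..<m} 1 = {\<lambda>i\<in>{..<m}. 0}"
      proof (intro equalityI subsetI, unfold singleton_iff)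
        fix g assume "g \<in> surjections {..<m} 1"
        then show "g = (\<lambda>i\<in>{..<m}. 0)"
          by (auto simp: surjections_def fun_eq_iff PiE_iff extensional_def)
      qed (use ne in \<open>auto simp: surjections_def\<close>)
      then have s1: "?s 1 = 1" by simp
      have "(\<Sum>j\<in>{1..<m}. (-1) ^ (j - 1) * ?N j) =
          (\<Sum>j\<in>{1..<m}. (-1) ^ (j - 1) * ?s j * stirling_parity_sum ?d j + (if j = 1 then ?s 1 * (-1) ^ ?d else 0))"
        by (intro sum.cong refl) (subst N, auto simp: algebra_simps)
      also have "\<dots> = (\<Sum>j\<in>{1..<m}. (-1) ^ (j - 1) * ?s j * stirling_parity_sum ?d j) + (-1) ^ ?d"
        using m unfolding sum.distrib s1 by simp
      finally show ?thesis .
    qed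
    finally have "(-1) ^ (m - 1) * real (positive_orders m b) +
        (\<Sum>j\<in>{1..<m}. (-1) ^ (j - 1) * ?s j * stirling_parity_sum ?d j) = 0" by simp
    \<comment> \<open>Orthogonality without its term \<open>j = 0\<close>, which vanishes because no
      map from a nonempty set has empty image. The coefficient at \<open>j = m\<close> is
      \<open>fact m / fact m\<close> up to sign, and the exponents are lowered by one.\<close>
    moreover have "(-1) ^ (m - 1) * stirling_parity_sum ?d m +
        (\<Sum>j\<in>{1..<m}. (-1) ^ (j - 1) * ?s j * stirling_parity_sum ?d j) = 0"
    proof -
      have "surjections {..<m} 0 = {}" using m surjections_lessD[of _ "{..<m}" 0 0] by fastforce
      then have s0: "?s 0 = 0" by simp
      have "{..m} = insert 0 (insert m {1..<m})" using m by auto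
      then have "(\<Sum>j\<le>m. (-1) ^ j * ?s j * stirling_parity_sum ?d j) =
          (-1) ^ m * stirling_parity_sum ?d m + (\<Sum>j\<in>{1..<m}. (-1) ^ j * ?s j * stirling_parity_sum ?d j)"
        using m s0 by (simp add: card_surjections_self)
      also have "\<dots> = - ((-1) ^ (m - 1) * stirling_parity_sum ?d m +
          (\<Sum>j\<in>{1..<m}. (-1) ^ (j - 1) * ?s j * stirling_parity_sum ?d j))"
      proof -
        have neg: "(-1) ^ j = - ((-1 :: real) ^ (j - 1))" if "1 \<le> j" for j
          using that by (cases j) auto
        have "(\<Sum>j\<in>{1..<m}. (-1) ^ j * ?s j * stirling_parity_sum ?d j) =
            - (\<Sum>j\<in>{1..<m}. (-1) ^ (j - 1) * ?s j * stirling_parity_sum ?d j)"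
          unfolding sum_negf[symmetric] by (intro sum.cong refl, subst neg) auto
        then show ?thesis using neg[of m] m by simp
      qed
      finally show ?thesis using stirling_parity_sum_orthogonal[of ?d m] m by simp
    qed
    ultimately have "(-1) ^ (m - 1) * real (positive_orders m b) = (-1) ^ (m - 1) * stirling_parity_sum ?d m"
      by linarith
    then show ?thesis using m by simp
  qed
qed

section \<open>Measurability and exchangeability\<close>

lemma zero_notin_convex_hull_iff:
  fixes S :: "'e::euclidean_space set"
  assumes "finite S"
  shows "0 \<notin> convex hull S \<longleftrightarrow> (\<exists>y. \<forall>x\<in>S. x \<bullet> y > 0)"
proof
  assume "0 \<notin> convex hull S"
  moreover have "closed (convex hull S)"
    using assms by (intro compact_imp_closed finite_imp_compact_convex_hull)
  ultimately obtain a b where "0 < b" and ab: "\<forall>x\<in>convex hull S. a \<bullet> x > b"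
    using separating_hyperplane_closed_0[OF convex_convex_hull] by blast
  have "x \<bullet> a > 0" if "x \<in> S" for x
    using bspec[OF ab hull_inc[OF that]] \<open>0 < b\<close> by (simp add: inner_commute)
  then show "\<exists>y. \<forall>x\<in>S. x \<bullet> y > 0" by blast
next
  assume "\<exists>y. \<forall>x\<in>S. x \<bullet> y > 0"
  then obtain y where "\<forall>x\<in>S. x \<bullet> y > 0" ..
  then have "convex hull S \<subseteq> {x. y \<bullet> x > 0}"
    by (intro hull_minimal convex_halfspace_gt) (auto simp: inner_commute)
  then show "0 \<notin> convex hull S" by auto
qed

lemma lin_dependent_family_mono:
  assumes "lin_dependent_family I v" "I \<subseteq> J" "finite J"
  shows "lin_dependent_family J v"
proof -
  obtain c where c: "\<exists>i\<in>I. c i \<noteq> 0" "(\<Sum>i\<in>I. c i *\<^sub>R v i) = 0"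
    using assms(1) unfolding lin_dependent_family_def by blast
  have "(\<Sum>i\<in>J. (if i \<in> I then c i else 0) *\<^sub>R v i) = (\<Sum>i\<in>I. c i *\<^sub>R v i)"
    using assms by (intro sum.mono_neutral_cong_right) auto
  then show ?thesis
    unfolding lin_dependent_family_def
    using c assms(2) by (intro exI[of _ "\<lambda>i. if i \<in> I then c i else 0"]) auto
qed

lemma span_image_le_range:
  fixes v :: "'i \<Rightarrow> 'e::real_vector"
  assumes "finite I"
  shows "span (v ` I) \<subseteq> range (\<lambda>c. \<Sum>i\<in>I. c i *\<^sub>R v i)"
proof (rule span_minimal)
  show "v ` I \<subseteq> range (\<lambda>c. \<Sum>i\<in>I. c i *\<^sub>R v i)"
  proof (intro image_subsetI)
    fix k assume k: "k \<in> I"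
    have "(\<Sum>i\<in>I. (if i = k then 1 else 0) *\<^sub>R v i) = (\<Sum>i\<in>I. if i = k then v i else 0)"
      by (intro sum.cong) auto
    also have "\<dots> = v k" using assms k by simp
    finally show "v k \<in> range (\<lambda>c. \<Sum>i\<in>I. c i *\<^sub>R v i)"
      by (intro range_eqI[of _ _ "\<lambda>i. if i = k then 1 else 0"]) (rule sym)
  qed
  show "subspace (range (\<lambda>c. \<Sum>i\<in>I. c i *\<^sub>R v i))"
  proof (rule subspaceI)
    show "0 \<in> range (\<lambda>c. \<Sum>i\<in>I. c i *\<^sub>R v i)"
      by (rule range_eqI[of _ _ "\<lambda>_. 0"]) simp
  next
    fix x y assume "x \<in> range (\<lambda>c. \<Sum>i\<in>I. c i *\<^sub>R v i)" "y \<in> range (\<lambda>c. \<Sum>i\<in>I. c i *\<^sub>R v i)"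
    then obtain c c' where "x = (\<Sum>i\<in>I. c i *\<^sub>R v i)" "y = (\<Sum>i\<in>I. c' i *\<^sub>R v i)" by blast
    then show "x + y \<in> range (\<lambda>c. \<Sum>i\<in>I. c i *\<^sub>R v i)"
      by (intro range_eqI[of _ _ "\<lambda>i. c i + c' i"]) (simp add: scaleR_left_distrib sum.distrib)
  next
    fix r :: real and x assume "x \<in> range (\<lambda>c. \<Sum>i\<in>I. c i *\<^sub>R v i)"
    then obtain c where "x = (\<Sum>i\<in>I. c i *\<^sub>R v i)" by blast
    then show "r *\<^sub>R x \<in> range (\<lambda>c. \<Sum>i\<in>I. c i *\<^sub>R v i)"
      by (intro range_eqI[of _ _ "\<lambda>i. r * c i"]) (simp add: scaleR_sum_right)
  qed
qed

text \<open>Induction: the component of the new vector orthogonal to the span of the earlier ones is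
  nonzero, and moving \<open>y\<close> along it adjusts the new value without disturbing the old
  ones.\<close>

lemma lin_independent_family_interpolates:
  fixes v :: "nat \<Rightarrow> real ^ 'd"
  assumes "finite I" "\<not> lin_dependent_family I v"
  shows "\<exists>y. \<forall>i\<in>I. v i \<bullet> y = h i"
  using assms
proof (induction I rule: finite_induct)
  case empty
  then show ?case by simp
next
  case (insert k I)
  then have "\<not> lin_dependent_family I v"
    using lin_dependent_family_mono[of I v "insert k I"] by auto
  then obtain y where y: "\<forall>i\<in>I. v i \<bullet> y = h i" using insert.IH by blast
  have "v k \<notin> span (v ` I)"
  proof
    assume "v k \<in> span (v ` I)"
    then obtain c where c: "v k = (\<Sum>i\<in>I. c i *\<^sub>R v i)"
      using span_image_le_range[OF insert.hyps(1), of v] by blast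
    have "(\<Sum>i\<in>insert k I. (if i = k then -1 else c i) *\<^sub>R v i) =
        - v k + (\<Sum>i\<in>I. (if i = k then -1 else c i) *\<^sub>R v i)"
      using insert.hyps by simp
    also have "(\<Sum>i\<in>I. (if i = k then -1 else c i) *\<^sub>R v i) = (\<Sum>i\<in>I. c i *\<^sub>R v i)"
      using insert.hyps by (intro sum.cong) auto
    finally have "(\<Sum>i\<in>insert k I. (if i = k then -1 else c i) *\<^sub>R v i) = 0" using c by simp
    then have "lin_dependent_family (insert k I) v"
      unfolding lin_dependent_family_def by (intro exI[of _ "\<lambda>i. if i = k then -1 else c i"]) auto
    then show False using insert.prems by blast
  qed
  moreover obtain p z where p: "p \<in> span (v ` I)" and z: "\<And>u. u \<in> span (v ` I) \<Longrightarrow> orthogonal z u"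
    and vk: "v k = p + z"
    by (rule orthogonal_subspace_decomp_exists[of "v ` I" "v k"]) (rule that)
  ultimately have "z \<noteq> 0" by auto
  have vkz: "v k \<bullet> z = z \<bullet> z"
    using z[OF p] by (simp add: vk inner_add_left orthogonal_def inner_commute[of p z])
  have viz: "v i \<bullet> z = 0" if "i \<in> I" for i
    using z[OF span_base[of "v i"]] that by (simp add: orthogonal_def inner_commute[of "v i" z])
  let ?t = "(h k - v k \<bullet> y) / (z \<bullet> z)"
  have "v i \<bullet> (y + ?t *\<^sub>R z) = h i" if "i \<in> insert k I" for i
    using that y viz \<open>z \<noteq> 0\<close> by (auto simp: inner_add_right vkz)
  then show ?case by blast
qed

text \<open>
  Strict diagonal dominance against test vectors is an open condition on these vectors, so they may be
  chosen in a countable dense set. This makes linear independence a measurable event.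
\<close>

lemma diagonally_dominant_imp_independent:
  fixes v :: "nat \<Rightarrow> real ^ 'd"
  assumes fin: "finite I"
    and dom: "\<And>i. i \<in> I \<Longrightarrow> \<exists>y. (\<Sum>k\<in>I - {i}. \<bar>v k \<bullet> y\<bar>) < \<bar>v i \<bullet> y\<bar>"
  shows "\<not> lin_dependent_family I v"
proof
  assume "lin_dependent_family I v"
  then obtain c where c: "\<exists>i\<in>I. c i \<noteq> 0" "(\<Sum>i\<in>I. c i *\<^sub>R v i) = 0"
    unfolding lin_dependent_family_def by blast
  then have "(\<lambda>i. \<bar>c i\<bar>) ` I \<noteq> {}" by auto
  \<comment> \<open>A coefficient of maximal absolute value is isolated; after pairing with
    \<open>y\<close>, the remaining terms are too small to cancel it.\<close>
  then have "Max ((\<lambda>i. \<bar>c i\<bar>) ` I) \<in> (\<lambda>i. \<bar>c i\<bar>) ` I" using fin by (intro Max_in) auto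
  then obtain i where i1: "i \<in> I" and max: "Max ((\<lambda>i. \<bar>c i\<bar>) ` I) = \<bar>c i\<bar>" by blast
  have i2: "\<bar>c k\<bar> \<le> \<bar>c i\<bar>" if "k \<in> I" for k
    unfolding max[symmetric] using fin that by (intro Max_ge) auto
  have ci: "\<bar>c i\<bar> > 0"
  proof -
    obtain k where "k \<in> I" "c k \<noteq> 0" using c(1) by blast
    then show ?thesis using i2[of k] by linarith
  qed
  obtain y where y: "(\<Sum>k\<in>I - {i}. \<bar>v k \<bullet> y\<bar>) < \<bar>v i \<bullet> y\<bar>" using dom[OF i1] by blast
  have "0 = (\<Sum>k\<in>I. c k *\<^sub>R v k) \<bullet> y" using c(2) by simp
  also have "\<dots> = (\<Sum>k\<in>I. c k * (v k \<bullet> y))" by (simp add: inner_sum_left)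
  also have "\<dots> = c i * (v i \<bullet> y) + (\<Sum>k\<in>I - {i}. c k * (v k \<bullet> y))"
    by (rule sum.remove[OF fin i1])
  finally have "\<bar>c i\<bar> * \<bar>v i \<bullet> y\<bar> = \<bar>\<Sum>k\<in>I - {i}. c k * (v k \<bullet> y)\<bar>"
    by (simp add: abs_mult[symmetric])
  also have "\<dots> \<le> (\<Sum>k\<in>I - {i}. \<bar>c k\<bar> * \<bar>v k \<bullet> y\<bar>)"
    by (rule order.trans[OF sum_abs]) (simp add: abs_mult)
  also have "\<dots> \<le> (\<Sum>k\<in>I - {i}. \<bar>c i\<bar> * \<bar>v k \<bullet> y\<bar>)"
    using i2 by (intro sum_mono mult_right_mono) auto
  also have "\<dots> = \<bar>c i\<bar> * (\<Sum>k\<in>I - {i}. \<bar>v k \<bullet> y\<bar>)" by (simp add: sum_distrib_left)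
  also have "\<dots> < \<bar>c i\<bar> * \<bar>v i \<bullet> y\<bar>" using y ci by (rule mult_strict_left_mono)
  finally show False by simp
qed

text \<open>Positivity on finitely many vectors is open, so a dense set of test vectors suffices; a
  countable one makes the event a countable union.\<close>

lemma positive_levels_dense:
  fixes b :: "'i \<Rightarrow> real ^ 'd"
  assumes D: "\<And>X. open X \<Longrightarrow> X \<noteq> {} \<Longrightarrow> \<exists>d\<in>D. d \<in> X"
  shows "positive_levels V b g j \<longleftrightarrow> (\<exists>y\<in>D. \<forall>l\<in>{1..<j}. (\<Sum>i | i \<in> V \<and> g i < l. b i) \<bullet> y > 0)"
proof
  assume "positive_levels V b g j"
  then have "(\<Inter>l\<in>{1..<j}. {y. (\<Sum>i | i \<in> V \<and> g i < l. b i) \<bullet> y > 0}) \<noteq> {}"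
    unfolding positive_levels_def by blast
  moreover have "open (\<Inter>l\<in>{1..<j}. {y. (\<Sum>i | i \<in> V \<and> g i < l. b i) \<bullet> y > 0})"
    by (intro open_INT ballI open_Collect_less continuous_intros) auto
  ultimately show "\<exists>y\<in>D. \<forall>l\<in>{1..<j}. (\<Sum>i | i \<in> V \<and> g i < l. b i) \<bullet> y > 0"
    using D by fastforce
qed (auto simp: positive_levels_def)

lemma interpolating_levels_dense:
  fixes b :: "'i \<Rightarrow> real ^ 'd"
  assumes D: "\<And>X. open X \<Longrightarrow> X \<noteq> {} \<Longrightarrow> \<exists>d\<in>D. d \<in> X"
  shows "interpolating_levels V b g j \<longleftrightarrow> (\<forall>l\<in>{1..<j}. \<exists>y\<in>D.
    (\<Sum>k\<in>{1..<j} - {l}. \<bar>(\<Sum>i | i \<in> V \<and> g i < k. b i) \<bullet> y\<bar>) < \<bar>(\<Sum>i | i \<in> V \<and> g i < l. b i) \<bullet> y\<bar>)"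
    (is "_ \<longleftrightarrow> (\<forall>l\<in>_. \<exists>y\<in>D. ?P l y)")
proof
  assume int: "interpolating_levels V b g j"
  show "\<forall>l\<in>{1..<j}. \<exists>y\<in>D. ?P l y"
  proof
    fix l assume l: "l \<in> {1..<j}"
    \<comment> \<open>A dual vector, 1 on level \<open>l\<close> and 0 on the others, is strictly
      dominant, so some point of \<open>D\<close> is too.\<close>
    obtain y where y: "\<forall>k\<in>{1..<j}. (\<Sum>i | i \<in> V \<and> g i < k. b i) \<bullet> y = (if k = l then 1 else 0)"
      using int[unfolded interpolating_levels_def, rule_format, of "\<lambda>k. if k = l then 1 else 0"] ..
    have "(\<Sum>k\<in>{1..<j} - {l}. \<bar>(\<Sum>i | i \<in> V \<and> g i < k. b i) \<bullet> y\<bar>) = 0"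
    proof (intro sum.neutral ballI)
      fix k assume "k \<in> {1..<j} - {l}"
      then show "\<bar>(\<Sum>i | i \<in> V \<and> g i < k. b i) \<bullet> y\<bar> = 0" using y[rule_format, of k] by auto
    qed
    moreover have "(\<Sum>i | i \<in> V \<and> g i < l. b i) \<bullet> y = 1" using y[rule_format, OF l] by auto
    ultimately have "?P l y" by simp
    then have "{y. ?P l y} \<noteq> {}" by blast
    moreover have "open {y. ?P l y}" by (intro open_Collect_less continuous_intros)
    ultimately show "\<exists>y\<in>D. ?P l y" using D by blast
  qed
next
  assume dom: "\<forall>l\<in>{1..<j}. \<exists>y\<in>D. ?P l y"
  have "\<not> lin_dependent_family {1..<j} (\<lambda>l. \<Sum>i | i \<in> V \<and> g i < l. b i)"
    by (rule diagonally_dominant_imp_independent) (use dom in blast)+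
  then show "interpolating_levels V b g j"
    unfolding interpolating_levels_def using lin_independent_family_interpolates by blast
qed

lemma measurable_level_sum:
  fixes X :: "'i \<Rightarrow> 'a \<Rightarrow> real ^ 'd"
  assumes "\<And>i. i \<in> V \<Longrightarrow> X i \<in> borel_measurable M"
  shows "(\<lambda>\<omega>. (\<Sum>i | i \<in> V \<and> g i < l. X i \<omega>) \<bullet> y) \<in> borel_measurable M"
  by (intro borel_measurable_inner borel_measurable_sum borel_measurable_const) (use assms in auto)

lemma pred_countable_bex:
  assumes "countable D" "\<And>y. y \<in> D \<Longrightarrow> Measurable.pred M (\<lambda>x. P x y)"
  shows "Measurable.pred M (\<lambda>x. \<exists>y\<in>D. P x y)"
  using sets.sets_Collect_countable_Ex'[of D M "\<lambda>y x. P x y"] assms by (simp add: pred_def)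

lemma pred_positive_levels:
  fixes X :: "'i \<Rightarrow> 'a \<Rightarrow> real ^ 'd"
  assumes "\<And>i. i \<in> V \<Longrightarrow> X i \<in> borel_measurable M"
  shows "Measurable.pred M (\<lambda>\<omega>. positive_levels V (\<lambda>i. X i \<omega>) g j)"
proof -
  obtain D :: "(real ^ 'd) set" where D: "countable D" "\<And>X. open X \<Longrightarrow> X \<noteq> {} \<Longrightarrow> \<exists>d\<in>D. d \<in> X"
    using countable_dense_exists[where 'a = "real ^ 'd"] by blast
  have [measurable]: "(\<lambda>\<omega>. (\<Sum>i | i \<in> V \<and> g i < l. X i \<omega>) \<bullet> y) \<in> borel_measurable M" for l y
    by (rule measurable_level_sum[OF assms])
  have "Measurable.pred M (\<lambda>\<omega>. \<exists>y\<in>D. \<forall>l\<in>{1..<j}. (\<Sum>i | i \<in> V \<and> g i < l. X i \<omega>) \<bullet> y > 0)"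
    by (rule pred_countable_bex[OF D(1)]) measurable
  then show ?thesis by (subst positive_levels_dense[OF D(2)])
qed

lemma pred_interpolating_levels:
  fixes X :: "'i \<Rightarrow> 'a \<Rightarrow> real ^ 'd"
  assumes "\<And>i. i \<in> V \<Longrightarrow> X i \<in> borel_measurable M"
  shows "Measurable.pred M (\<lambda>\<omega>. interpolating_levels V (\<lambda>i. X i \<omega>) g j)"
proof -
  obtain D :: "(real ^ 'd) set" where D: "countable D" "\<And>X. open X \<Longrightarrow> X \<noteq> {} \<Longrightarrow> \<exists>d\<in>D. d \<in> X"
    using countable_dense_exists[where 'a = "real ^ 'd"] by blast
  have [measurable]: "(\<lambda>\<omega>. (\<Sum>i | i \<in> V \<and> g i < l. X i \<omega>) \<bullet> y) \<in> borel_measurable M" for l y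
    by (rule measurable_level_sum[OF assms])
  have "Measurable.pred M (\<lambda>\<omega>. \<forall>l\<in>{1..<j}. \<exists>y\<in>D.
      (\<Sum>k\<in>{1..<j} - {l}. \<bar>(\<Sum>i | i \<in> V \<and> g i < k. X i \<omega>) \<bullet> y\<bar>)
        < \<bar>(\<Sum>i | i \<in> V \<and> g i < l. X i \<omega>) \<bullet> y\<bar>)"
    by (intro pred_intros_finite(3) finite_atLeastLessThan, rule pred_countable_bex[OF D(1)]) measurable
  then show ?thesis by (subst interpolating_levels_dense[OF D(2)])
qed

section \<open>Invariance under permutations of the steps\<close>

lemma level_sum_permute:
  assumes "\<sigma> permutes V"
  shows "(\<Sum>i | i \<in> V \<and> (\<lambda>i\<in>V. g (\<sigma> i)) i < l. b (\<sigma> i)) = (\<Sum>i | i \<in> V \<and> g i < l. b i)"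
  by (rule sum.reindex_bij_witness[where i = "inv \<sigma>" and j = \<sigma>])
     (use assms in \<open>auto simp: permutes_in_image permutes_inverses permutes_in_image[OF permutes_inv]\<close>)

lemma positive_levels_permute:
  assumes "\<sigma> permutes V"
  shows "positive_levels V (\<lambda>i. b (\<sigma> i)) (\<lambda>i\<in>V. g (\<sigma> i)) j \<longleftrightarrow> positive_levels V b g j"
  by (simp only: positive_levels_def level_sum_permute[OF assms])

lemma interpolating_levels_permute:
  assumes "\<sigma> permutes V"
  shows "interpolating_levels V (\<lambda>i. b (\<sigma> i)) (\<lambda>i\<in>V. g (\<sigma> i)) j \<longleftrightarrow> interpolating_levels V b g j"
  by (simp only: interpolating_levels_def level_sum_permute[OF assms])

lemma level_sum_cong:
  assumes "\<And>i. i \<in> V \<Longrightarrow> b i = b' i"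
  shows "(\<Sum>i | i \<in> V \<and> g i < l. b i) = (\<Sum>i | i \<in> V \<and> g i < l. b' i)"
  using assms by (intro sum.cong) auto

text \<open>Permuting the steps and the block map together changes no level sum, and permuting the
  steps alone changes no distribution. Hence permuting the block map alone preserves the
  expectation.\<close>

lemma exchangeable_positive_levels:
  fixes \<xi> :: "nat \<Rightarrow> 'a \<Rightarrow> real ^ 'd"
  assumes rv: "\<And>i. i \<in> {1..n} \<Longrightarrow> \<xi> i \<in> borel_measurable M"
    and ex: "exchangeable M n \<xi>" and \<sigma>: "\<sigma> permutes {1..n}"
  shows "(\<integral>\<omega>. of_bool (positive_levels {1..n} (\<lambda>i. \<xi> i \<omega>) (\<lambda>i\<in>{1..n}. g (\<sigma> i)) j) \<partial>M) =
    (\<integral>\<omega>. of_bool (positive_levels {1..n} (\<lambda>i. \<xi> i \<omega>) g j) \<partial>M :: real)"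
proof -
  let ?V = "{1..n}" and ?N = "\<Pi>\<^sub>M i\<in>{1..n}. (borel :: (real ^ 'd) measure)"
  let ?f = "\<lambda>x. of_bool (positive_levels ?V x (\<lambda>i\<in>?V. g (\<sigma> i)) j) :: real"
  have "Measurable.pred ?N (\<lambda>x. positive_levels ?V (\<lambda>i. x i) (\<lambda>i\<in>?V. g (\<sigma> i)) j)"
    by (rule pred_positive_levels) simp
  then have f: "?f \<in> borel_measurable ?N" by simp
  have f_restrict: "?f (restrict b ?V) = ?f b" for b
    unfolding positive_levels_def by (subst level_sum_cong[of _ "restrict b ?V" b]) auto
  have T: "(\<lambda>\<omega>. \<lambda>i\<in>?V. \<xi> (\<rho> i) \<omega>) \<in> M \<rightarrow>\<^sub>M ?N" if "\<rho> permutes ?V" for \<rho>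
    using rv permutes_in_image[OF that] by (intro measurable_restrict) auto
  have eq: "integral\<^sup>L (distr M ?N (\<lambda>\<omega>. \<lambda>i\<in>?V. \<xi> (\<rho> i) \<omega>)) ?f = (\<integral>\<omega>. ?f (\<lambda>i. \<xi> (\<rho> i) \<omega>) \<partial>M)"
    if "\<rho> permutes ?V" for \<rho>
    by (subst integral_distr[OF T[OF that] f]) (simp only: f_restrict)
  have "(\<integral>\<omega>. ?f (\<lambda>i. \<xi> i \<omega>) \<partial>M) = (\<integral>\<omega>. ?f (\<lambda>i. \<xi> (\<sigma> i) \<omega>) \<partial>M)"
    using eq[OF \<sigma>] eq[OF permutes_id] ex[unfolded exchangeable_def, rule_format, OF \<sigma>]
    by (simp only: id_apply)
  moreover have "positive_levels ?V (\<lambda>i. \<xi> (\<sigma> i) \<omega>) (\<lambda>i\<in>?V. g (\<sigma> i)) j \<longleftrightarrow>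
      positive_levels ?V (\<lambda>i. \<xi> i \<omega>) g j" for \<omega>
    by (rule positive_levels_permute[OF \<sigma>, where b = "\<lambda>i. \<xi> i \<omega>"])
  ultimately show ?thesis by (simp only:)
qed

text \<open>The almost sure version of the same argument, which carries independence from a
  rearranged partition to the original one.\<close>

lemma exchangeable_AE_interpolating_levels:
  fixes \<xi> :: "nat \<Rightarrow> 'a \<Rightarrow> real ^ 'd"
  assumes rv: "\<And>i. i \<in> {1..n} \<Longrightarrow> \<xi> i \<in> borel_measurable M"
    and ex: "exchangeable M n \<xi>" and \<sigma>: "\<sigma> permutes {1..n}"
    and AE: "AE \<omega> in M. interpolating_levels {1..n} (\<lambda>i. \<xi> i \<omega>) (\<lambda>i\<in>{1..n}. g (\<sigma> i)) j"
  shows "AE \<omega> in M. interpolating_levels {1..n} (\<lambda>i. \<xi> i \<omega>) g j"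
proof -
  let ?V = "{1..n}" and ?N = "\<Pi>\<^sub>M i\<in>{1..n}. (borel :: (real ^ 'd) measure)"
  let ?f = "\<lambda>x. interpolating_levels ?V x (\<lambda>i\<in>?V. g (\<sigma> i)) j"
  have "Measurable.pred ?N (\<lambda>x. interpolating_levels ?V (\<lambda>i. x i) (\<lambda>i\<in>?V. g (\<sigma> i)) j)"
    by (rule pred_interpolating_levels) simp
  then have f: "{x \<in> space ?N. ?f x} \<in> sets ?N" by (simp add: pred_def)
  have f_restrict: "?f (restrict b ?V) = ?f b" for b
    unfolding interpolating_levels_def by (subst level_sum_cong[of _ "restrict b ?V" b]) auto
  have T: "(\<lambda>\<omega>. \<lambda>i\<in>?V. \<xi> (\<rho> i) \<omega>) \<in> M \<rightarrow>\<^sub>M ?N" if "\<rho> permutes ?V" for \<rho>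
    using rv permutes_in_image[OF that] by (intro measurable_restrict) auto
  have eq: "(AE x in distr M ?N (\<lambda>\<omega>. \<lambda>i\<in>?V. \<xi> (\<rho> i) \<omega>). ?f x) \<longleftrightarrow> (AE \<omega> in M. ?f (\<lambda>i. \<xi> (\<rho> i) \<omega>))"
    if "\<rho> permutes ?V" for \<rho>
    by (subst AE_distr_iff[OF T[OF that] f]) (simp only: f_restrict)
  have "AE \<omega> in M. ?f (\<lambda>i. \<xi> (\<sigma> i) \<omega>)"
    using eq[OF \<sigma>] eq[OF permutes_id] ex[unfolded exchangeable_def, rule_format, OF \<sigma>] AE
    by (simp only: id_apply)
  moreover have "interpolating_levels ?V (\<lambda>i. \<xi> (\<sigma> i) \<omega>) (\<lambda>i\<in>?V. g (\<sigma> i)) j \<longleftrightarrow>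
      interpolating_levels ?V (\<lambda>i. \<xi> i \<omega>) g j" for \<omega>
    by (rule interpolating_levels_permute[OF \<sigma>, where b = "\<lambda>i. \<xi> i \<omega>"])
  ultimately show ?thesis by (simp only:)
qed

section \<open>Random bridges\<close>

definition index_sets :: "nat \<Rightarrow> nat \<Rightarrow> nat set set" where
  "index_sets n k = {I. I \<subseteq> {1..n - 1} \<and> card I = k}"

lemma finite_index_sets: "finite (index_sets n k)"
  by (rule finite_subset[of _ "Pow {1..n - 1}"]) (auto simp: index_sets_def)

lemma card_index_sets: "card (index_sets n k) = (n - 1) choose k"
  using n_subsets[of "{1..n - 1}" k] by (simp add: index_sets_def)

definition levels :: "nat \<Rightarrow> (nat \<Rightarrow> nat) \<Rightarrow> nat \<Rightarrow> nat set set" where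
  "levels n g j = (\<lambda>l. {i \<in> {1..n}. g i < l}) ` {1..<j}"

text \<open>
  The index set \<open>I\<close> cuts \<open>{1..n}\<close> into consecutive blocks, and this is the map sending an
  element to the number of its block. The \<^const>\<open>inv_into\<close> is meaningful only for \<open>I \<subseteq> {1..n - 1}\<close>.
\<close>

definition composition_blocks :: "nat \<Rightarrow> nat set \<Rightarrow> nat \<Rightarrow> nat" where
  "composition_blocks n I =
     inv_into (surjections {1..n} (card I + 1)) (\<lambda>g. levels n g (card I + 1)) ((\<lambda>s. {1..s}) ` I)"

lemma bij_betw_levels:
  assumes "1 \<le> n"
  shows "bij_betw (\<lambda>g. levels n g (k + 1)) (surjections {1..n} (k + 1))
    {c \<in> subset_chains {1..n}. card c = k}"
  using bij_betw_surjections_subset_chains[of "{1..n}" "k + 1"] assms by (simp add: levels_def)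

lemma inj_on_initial_segments: "inj_on (\<lambda>s :: nat. {1..s}) A"
  by (rule inj_on_inverseI[of _ card]) simp

lemma composition_blocks:
  assumes "1 \<le> n" "I \<in> index_sets n k"
  shows "composition_blocks n I \<in> surjections {1..n} (k + 1)"
    and "levels n (composition_blocks n I) (k + 1) = (\<lambda>s. {1..s}) ` I"
proof -
  have I: "I \<subseteq> {1..n - 1}" "card I = k" using assms(2) by (auto simp: index_sets_def)
  have "(\<lambda>s. {1..s}) ` I \<in> {c \<in> subset_chains {1..n}. card c = k}"
  proof (intro CollectI conjI)
    show "card ((\<lambda>s. {1..s}) ` I) = k" unfolding card_image[OF inj_on_initial_segments] by (rule I(2))
    show "(\<lambda>s. {1..s}) ` I \<in> subset_chains {1..n}"
      unfolding subset_chains_def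
    proof (rule CollectI, intro conjI ballI subsetI)
      fix A assume "A \<in> (\<lambda>s. {1..s}) ` I"
      then obtain s where s: "s \<in> I" "A = {1..s}" by blast
      then have "s \<in> {1..n - 1}" using I(1) by blast
      then have "n \<in> {1..n} - A" "A \<subseteq> {1..n}" "1 \<in> A" using s(2) by auto
      then show "A \<in> {A. A \<subset> {1..n} \<and> A \<noteq> {}}" by blast
    next
      fix A B assume "A \<in> (\<lambda>s. {1..s}) ` I" "B \<in> (\<lambda>s. {1..s}) ` I"
      then obtain s t :: nat where "A = {1..s}" "B = {1..t}" by blast
      then show "A \<subseteq> B \<or> B \<subseteq> A" using nat_le_linear[of s t] by auto
    qed
  qed
  then have "(\<lambda>s. {1..s}) ` I \<in> (\<lambda>g. levels n g (k + 1)) ` surjections {1..n} (k + 1)"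
    using bij_betw_imp_surj_on[OF bij_betw_levels[OF assms(1)]] by blast
  then show "composition_blocks n I \<in> surjections {1..n} (k + 1)"
    and "levels n (composition_blocks n I) (k + 1) = (\<lambda>s. {1..s}) ` I"
    unfolding composition_blocks_def I(2)
    by (rule inv_into_into, rule f_inv_into_f)
qed

lemma mono_arrangement:
  fixes g :: "nat \<Rightarrow> nat"
  obtains \<sigma> where "\<sigma> permutes {1..n}" "\<And>i j. 1 \<le> i \<Longrightarrow> i \<le> j \<Longrightarrow> j \<le> n \<Longrightarrow> g (\<sigma> i) \<le> g (\<sigma> j)"
proof -
  \<comment> \<open>Sorting lists the elements block by block; the list is indexed from 0, hence the
    shift in \<open>\<sigma>\<close>.\<close>
  define xs where "xs = sort_key g [1..<n + 1]"
  have xs: "length xs = n" "distinct xs" "set xs = {1..n}"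
    by (auto simp: xs_def)
  define \<sigma> where "\<sigma> i = (if i \<in> {1..n} then xs ! (i - 1) else i)" for i
  have "bij_betw (\<lambda>i. i - 1) {1..n} {..<n}"
    by (rule bij_betwI[where g = Suc]) auto
  moreover have "bij_betw ((!) xs) {..<n} {1..n}"
    using bij_betw_nth[OF xs(2), of "{..<n}" "{1..n}"] xs by simp
  ultimately have "bij_betw ((!) xs \<circ> (\<lambda>i. i - 1)) {1..n} {1..n}" by (rule bij_betw_trans)
  then have "bij_betw \<sigma> {1..n} {1..n}"
    by (subst bij_betw_cong[of _ _ "(!) xs \<circ> (\<lambda>i. i - 1)"]) (auto simp: \<sigma>_def)
  then have "\<sigma> permutes {1..n}" by (rule bij_imp_permutes) (simp only: \<sigma>_def if_False)
  moreover have "g (\<sigma> i) \<le> g (\<sigma> j)" if "1 \<le> i" "i \<le> j" "j \<le> n" for i j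
  proof -
    have "sorted (map g xs)" by (simp add: xs_def)
    then have "map g xs ! (i - 1) \<le> map g xs ! (j - 1)"
      using that xs(1) by (intro sorted_nth_mono) auto
    then show ?thesis using that xs(1) by (auto simp: \<sigma>_def)
  qed
  ultimately show ?thesis using that by blast
qed

lemma initial_segment_eq:
  assumes "D \<subseteq> {1..n}" "\<And>i j. 1 \<le> i \<Longrightarrow> i \<le> j \<Longrightarrow> j \<in> D \<Longrightarrow> i \<in> D"
  shows "D = {1..card D}"
proof (cases "D = {}")
  case False
  have fin: "finite D" using assms(1) finite_subset by blast
  have "D = {1..Max D}"
  proof (intro equalityI subsetI)
    fix i assume "i \<in> D"
    then show "i \<in> {1..Max D}" using assms(1) fin by auto
  next
    fix i assume "i \<in> {1..Max D}"
    then show "i \<in> D" using assms(2)[of i "Max D"] Max_in[OF fin False] by auto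
  qed
  then show ?thesis by (metis card_atLeastAtMost diff_Suc_1)
qed simp

text \<open>For consecutive blocks these sizes are the cut points themselves, so they recover the
  index set; permuting the elements does not change them.\<close>

definition level_sizes :: "nat \<Rightarrow> (nat \<Rightarrow> nat) \<Rightarrow> nat \<Rightarrow> nat set" where
  "level_sizes n g j = card ` levels n g j"

lemma card_level_permute:
  assumes "\<sigma> permutes {1..n}"
  shows "card {i \<in> {1..n}. (\<lambda>i\<in>{1..n}. g (\<sigma> i)) i < l} = card {i \<in> {1..n}. g i < l}"
  unfolding card_eq_sum by (rule level_sum_permute[OF assms, where b = "\<lambda>_. 1"])

lemma level_sizes_permute:
  assumes "\<sigma> permutes {1..n}"
  shows "level_sizes n (\<lambda>i\<in>{1..n}. g (\<sigma> i)) j = level_sizes n g j"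
  unfolding level_sizes_def levels_def image_image card_level_permute[OF assms] ..

lemma level_sizes_composition_blocks:
  assumes "1 \<le> n" "I \<in> index_sets n k"
  shows "level_sizes n (composition_blocks n I) (k + 1) = I"
  unfolding level_sizes_def composition_blocks(2)[OF assms] image_image by simp

text \<open>Once the elements are sorted by block number, every level is an initial segment, so the
  block map is that of the index set formed by the level sizes.\<close>

lemma surjection_arrangement:
  assumes n: "1 \<le> n" and g: "g \<in> surjections {1..n} (k + 1)"
  obtains \<sigma> where "\<sigma> permutes {1..n}" "level_sizes n g (k + 1) \<in> index_sets n k"
    "(\<lambda>i\<in>{1..n}. g (\<sigma> i)) = composition_blocks n (level_sizes n g (k + 1))"
proof -
  obtain \<sigma> where \<sigma>: "\<sigma> permutes {1..n}" and mono: "\<And>i j. 1 \<le> i \<Longrightarrow> i \<le> j \<Longrightarrow> j \<le> n \<Longrightarrow> g (\<sigma> i) \<le> g (\<sigma> j)"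
    by (rule mono_arrangement[of n g]) (rule that)
  let ?g = "\<lambda>i\<in>{1..n}. g (\<sigma> i)" and ?I = "level_sizes n g (k + 1)"
  have g': "?g \<in> surjections {1..n} (k + 1)"
  proof -
    have "?g ` {1..n} = g ` \<sigma> ` {1..n}" by auto
    also have "\<dots> = {..<k + 1}" using g by (simp only: permutes_image[OF \<sigma>] surjections_def mem_Collect_eq)
    finally have img: "?g ` {1..n} = {..<k + 1}" .
    have "?g \<in> {1..n} \<rightarrow>\<^sub>E {..<k + 1}"
    proof (rule PiE_I)
      fix i assume "i \<in> {1..n}"
      then show "?g i \<in> {..<k + 1}" unfolding img[symmetric] by (rule imageI)
    qed auto
    then show ?thesis using img unfolding surjections_def by blast
  qed
  have chain: "levels n ?g (k + 1) \<in> {c \<in> subset_chains {1..n}. card c = k}"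
    using bij_betw_levels[OF n] g' by (rule bij_betwE[THEN bspec])
  have seg: "A = {1..card A}" if mem: "A \<in> levels n ?g (k + 1)" for A
  proof -
    obtain l where A: "A = {i \<in> {1..n}. ?g i < l}" using mem unfolding levels_def by blast
    show ?thesis
    proof (rule initial_segment_eq[of A n])
      fix i j assume "1 \<le> i" "i \<le> j" "j \<in> A"
      then show "i \<in> A" using mono[of i j] by (auto simp: A)
    qed (auto simp: A)
  qed
  have sizes: "card ` levels n ?g (k + 1) = ?I"
    using level_sizes_permute[OF \<sigma>, of g "k + 1"] by (simp add: level_sizes_def)
  have "(\<lambda>s. {1..s}) ` ?I = levels n ?g (k + 1)"
    unfolding sizes[symmetric] image_image using seg by simp
  have I: "?I \<in> index_sets n k"
    unfolding index_sets_def
  proof (intro CollectI conjI subsetI)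
    have "inj_on card (levels n ?g (k + 1))" by (rule inj_on_inverseI[of _ "\<lambda>s. {1..s}"]) (use seg in auto)
    then show "card ?I = k" using chain unfolding sizes[symmetric] by (simp add: card_image)
    fix s assume "s \<in> ?I"
    then obtain A where A: "A \<in> levels n ?g (k + 1)" "s = card A" unfolding sizes[symmetric] by blast
    have "levels n ?g (k + 1) \<subseteq> {A. A \<subset> {1..n} \<and> A \<noteq> {}}"
      using chain unfolding subset_chains_def by blast
    then have "A \<subset> {1..n}" "A \<noteq> {}" using A(1) by blast+
    then have "0 < card A" "card A < card {1..n}"
      using psubset_card_mono[of "{1..n}" A] by (auto simp: card_gt_0_iff intro: finite_subset)
    then show "s \<in> {1..n - 1}" using A(2) by auto
  qed
  have "composition_blocks n ?I = ?g"
  proof (rule inj_onD[OF bij_betw_imp_inj_on[OF bij_betw_levels[OF n, of k]]])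
    show "levels n (composition_blocks n ?I) (k + 1) = levels n ?g (k + 1)"
      unfolding composition_blocks(2)[OF n I] by fact
  qed (rule composition_blocks(1)[OF n I], rule g')
  then show ?thesis by (rule that[OF \<sigma> I sym])
qed

lemma positive_levels_composition_blocks:
  assumes "1 \<le> n" "I \<in> index_sets n k"
  shows "positive_levels {1..n} (\<lambda>i. \<xi> i \<omega>) (composition_blocks n I) (k + 1) \<longleftrightarrow>
    0 \<notin> convex hull ((\<lambda>i. partial_sums \<xi> i \<omega>) ` I)"
proof -
  have "finite I" using assms(2) finite_subset by (auto simp: index_sets_def)
  then have "0 \<notin> convex hull ((\<lambda>i. partial_sums \<xi> i \<omega>) ` I) \<longleftrightarrow>
      (\<exists>y. \<forall>s\<in>I. partial_sums \<xi> s \<omega> \<bullet> y > 0)"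
    by (subst zero_notin_convex_hull_iff) auto
  also have "\<dots> \<longleftrightarrow> (\<exists>y. \<forall>A\<in>(\<lambda>s. {1..s}) ` I. (\<Sum>i\<in>A. \<xi> i \<omega>) \<bullet> y > 0)"
    by (simp add: partial_sums_def)
  also have "\<dots> \<longleftrightarrow> positive_levels {1..n} (\<lambda>i. \<xi> i \<omega>) (composition_blocks n I) (k + 1)"
    unfolding positive_levels_def composition_blocks(2)[OF assms, symmetric] levels_def by simp
  finally show ?thesis by simp
qed

lemma interpolating_levels_composition_blocks:
  assumes n: "1 \<le> n" and I: "I \<in> index_sets n k"
    and ind: "\<not> lin_dependent_family I (\<lambda>i. partial_sums \<xi> i \<omega>)"
  shows "interpolating_levels {1..n} (\<lambda>i. \<xi> i \<omega>) (composition_blocks n I) (k + 1)"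
  unfolding interpolating_levels_def
proof
  fix h :: "nat \<Rightarrow> real"
  let ?g = "composition_blocks n I"
  let ?L = "\<lambda>l. {i \<in> {1..n}. ?g i < l}"
  have L: "?L ` {1..<k + 1} = (\<lambda>s. {1..s}) ` I"
    using composition_blocks(2)[OF n I] by (simp only: levels_def)
  have "card I = k" using I by (simp add: index_sets_def)
  then have "card (?L ` {1..<k + 1}) = card {1..<k + 1}"
    unfolding L card_image[OF inj_on_initial_segments] by simp
  then have inj: "inj_on ?L {1..<k + 1}" by (intro eq_card_imp_inj_on) auto
  have "finite I" using I finite_subset by (auto simp: index_sets_def)
  \<comment> \<open>Values are prescribed by the level number \<open>l\<close>, whereas the
    independent family is indexed by \<open>s \<in> I\<close>; the inverse of \<open>?L\<close>
    translates between them.\<close>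
  from lin_independent_family_interpolates[OF this ind, of "\<lambda>s. h (the_inv_into {1..<k + 1} ?L {1..s})"]
  obtain y where y: "\<forall>s\<in>I. partial_sums \<xi> s \<omega> \<bullet> y = h (the_inv_into {1..<k + 1} ?L {1..s})" ..
  have "(\<Sum>i\<in>?L l. \<xi> i \<omega>) \<bullet> y = h l" if l: "l \<in> {1..<k + 1}" for l
  proof -
    have "?L l \<in> (\<lambda>s. {1..s}) ` I" unfolding L[symmetric] using l by (rule imageI)
    then obtain s where s: "s \<in> I" "?L l = {1..s}" by blast
    have "(\<Sum>i\<in>?L l. \<xi> i \<omega>) \<bullet> y = h (the_inv_into {1..<k + 1} ?L (?L l))"
      unfolding s(2) using y s(1) by (simp add: partial_sums_def)
    then show ?thesis by (simp only: the_inv_into_f_f[OF inj l])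
  qed
  then show "\<exists>y. \<forall>l\<in>{1..<k + 1}. (\<Sum>i | i \<in> {1..n} \<and> ?g i < l. \<xi> i \<omega>) \<bullet> y = h l" by blast
qed

text \<open>General position speaks only of consecutive blocks. Every ordered partition is a
  rearrangement of such blocks, and exchangeability carries almost sure independence over; there are
  finitely many partitions.\<close>

lemma random_bridge_AE_generic_steps:
  fixes \<xi> :: "nat \<Rightarrow> 'a \<Rightarrow> real ^ 'd"
  assumes rb: "random_bridge M n \<xi>" and n: "1 \<le> n"
  shows "AE \<omega> in M. generic_steps {1..n} (\<lambda>i. \<xi> i \<omega>)"
proof -
  have rv: "\<And>i. i \<in> {1..n} \<Longrightarrow> \<xi> i \<in> borel_measurable M" and ex: "exchangeable M n \<xi>"
    and gp: "general_position M n (min CARD('d) (n - 1)) \<xi>"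
    using rb by (auto simp: random_bridge_def)
  have "AE \<omega> in M. interpolating_levels {1..n} (\<lambda>i. \<xi> i \<omega>) g j"
    if j: "j \<le> CARD('d) + 1" and g: "g \<in> surjections {1..n} j" for j g
  proof -
    obtain i where "i \<in> {1..n}" using n by auto
    then have "0 < j" using surjections_lessD[OF g] by fastforce
    then obtain k where k: "j = k + 1" by (metis Suc_eq_plus1 gr0_implies_Suc)
    obtain \<sigma> where \<sigma>: "\<sigma> permutes {1..n}" and I: "level_sizes n g (k + 1) \<in> index_sets n k"
      and eq: "(\<lambda>i\<in>{1..n}. g (\<sigma> i)) = composition_blocks n (level_sizes n g (k + 1))"
      using surjection_arrangement[OF n] g unfolding k by metis
    let ?I = "level_sizes n g (k + 1)"
    have I': "?I \<subseteq> {1..n - 1}" "card ?I = k" using I by (auto simp: index_sets_def)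
    have "k \<le> n - 1" using card_mono[OF _ I'(1)] I'(2) by simp
    \<comment> \<open>Here \<open>k \<le> CARD('d)\<close> and \<open>k \<le> n - 1\<close>, so the
      index set can be enlarged to the size for which general position is assumed; subfamilies
      inherit independence.\<close>
    then obtain J where J: "?I \<subseteq> J" "J \<subseteq> {1..n - 1}" "card J = min CARD('d) (n - 1)"
      using exists_subset_between[of ?I "min CARD('d) (n - 1)" "{1..n - 1}"] I' j k by auto
    have "AE \<omega> in M. \<not> lin_dependent_family J (\<lambda>i. partial_sums \<xi> i \<omega>)"
      using gp J by (simp add: general_position_def)
    then have "AE \<omega> in M. interpolating_levels {1..n} (\<lambda>i. \<xi> i \<omega>) (\<lambda>i\<in>{1..n}. g (\<sigma> i)) j"
    proof eventually_elim
      case (elim \<omega>)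
      then have "\<not> lin_dependent_family ?I (\<lambda>i. partial_sums \<xi> i \<omega>)"
        using lin_dependent_family_mono J finite_subset[OF J(2)] by blast
      then show ?case unfolding eq k by (rule interpolating_levels_composition_blocks[OF n I])
    qed
    from exchangeable_AE_interpolating_levels[OF _ ex \<sigma> this] rv show ?thesis by blast
  qed
  then have "AE \<omega> in M. \<forall>j\<in>{..CARD('d) + 1}. \<forall>g\<in>surjections {1..n} j.
      interpolating_levels {1..n} (\<lambda>i. \<xi> i \<omega>) g j"
    by (intro AE_finite_allI finite_surjections) auto
  then show ?thesis by eventually_elim (simp add: generic_steps_def)
qed

text \<open>Equal cut points mean that the two relabelled block maps agree up to permutations of the
  elements. There \<open>\<tau>\<close> cancels by injectivity, and the level sizes, invariant under
  such permutations, give back both index sets.\<close>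

lemma inj_on_level_sizes_comp:
  assumes n: "1 \<le> n" and \<tau>: "\<tau> \<in> surjections {..<k + 1} (k + 1)"
  shows "inj_on (\<lambda>I. level_sizes n (\<lambda>i\<in>{1..n}. \<tau> (composition_blocks n I i)) (k + 1)) (index_sets n k)"
proof (rule inj_onI)
  let ?h = "composition_blocks n" and ?t = "\<lambda>I. \<lambda>i\<in>{1..n}. \<tau> (composition_blocks n I i)"
  fix I J assume I: "I \<in> index_sets n k" and J: "J \<in> index_sets n k"
    and eq: "level_sizes n (?t I) (k + 1) = level_sizes n (?t J) (k + 1)"
  obtain \<sigma> where \<sigma>: "\<sigma> permutes {1..n}"
      "(\<lambda>i\<in>{1..n}. ?t I (\<sigma> i)) = composition_blocks n (level_sizes n (?t I) (k + 1))"
    using surjection_arrangement[OF n comp_surjections[OF composition_blocks(1)[OF n I] \<tau>]] by metis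
  obtain \<rho> where \<rho>: "\<rho> permutes {1..n}"
      "(\<lambda>i\<in>{1..n}. ?t J (\<rho> i)) = composition_blocks n (level_sizes n (?t J) (k + 1))"
    using surjection_arrangement[OF n comp_surjections[OF composition_blocks(1)[OF n J] \<tau>]] by metis
  have "(\<lambda>i\<in>{1..n}. ?h I (\<sigma> i)) = (\<lambda>i\<in>{1..n}. ?h J (\<rho> i))"
  proof (rule restrict_ext)
    fix i assume i: "i \<in> {1..n}"
    then have mem: "\<sigma> i \<in> {1..n}" "\<rho> i \<in> {1..n}"
      using permutes_in_image[OF \<sigma>(1)] permutes_in_image[OF \<rho>(1)] by blast+
    have "(\<lambda>i\<in>{1..n}. ?t I (\<sigma> i)) i = (\<lambda>i\<in>{1..n}. ?t J (\<rho> i)) i"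
      using \<sigma>(2) \<rho>(2) eq by simp
    then have "\<tau> (?h I (\<sigma> i)) = \<tau> (?h J (\<rho> i))" using i mem by simp
    moreover have "?h I (\<sigma> i) \<in> {..<k + 1}" "?h J (\<rho> i) \<in> {..<k + 1}"
      using surjections_lessD[OF composition_blocks(1)[OF n I] mem(1)]
        surjections_lessD[OF composition_blocks(1)[OF n J] mem(2)] by auto
    ultimately show "?h I (\<sigma> i) = ?h J (\<rho> i)"
      using bij_betw_imp_inj_on[OF bij_betw_surjection_self[OF \<tau>]] by (metis inj_onD)
  qed
  then have "level_sizes n (?h I) (k + 1) = level_sizes n (?h J) (k + 1)"
    using level_sizes_permute[OF \<sigma>(1), of "?h I"] level_sizes_permute[OF \<rho>(1), of "?h J"] by metis
  then show "I = J" using level_sizes_composition_blocks[OF n] I J by metis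
qed

text \<open>The expectation is averaged over all orders of the \<open>k + 1\<close> blocks cut out
  by each index set. By exchangeability each order gives the same total, and for almost every
  outcome the sum over the orders is the deterministic count.\<close>

lemma expectation_M_count:
  fixes \<xi> :: "nat \<Rightarrow> 'a \<Rightarrow> real ^ 'd"
  assumes rb: "random_bridge M n \<xi>" and k: "k \<in> {1..n - 1}"
  shows "(\<integral>\<omega>. M_count n k \<xi> \<omega> \<partial>M) =
    real ((n - 1) choose k) * stirling_parity_sum CARD('d) (k + 1) / (2 * fact (k + 1))"
proof -
  interpret prob_space M using rb by (simp add: random_bridge_def)
  have rv: "\<And>i. i \<in> {1..n} \<Longrightarrow> \<xi> i \<in> borel_measurable M" and ex: "exchangeable M n \<xi>"
    and br: "AE \<omega> in M. partial_sums \<xi> n \<omega> = 0"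
    using rb by (auto simp: random_bridge_def bridge_property_def)
  have n: "1 \<le> n" using k by auto
  let ?h = "composition_blocks n" and ?S = "surjections {..<k + 1} (k + 1)"
  define X :: "(nat \<Rightarrow> nat) \<Rightarrow> 'a \<Rightarrow> real"
    where "X g \<omega> = of_bool (positive_levels {1..n} (\<lambda>i. \<xi> i \<omega>) g (k + 1))" for g \<omega>
  \<comment> \<open>\<open>\<Phi> \<tau> I\<close> is the index set obtained when the blocks of
    \<open>I\<close> are placed consecutively in the order given by \<open>\<tau>\<close>.\<close>
  define \<Phi> where "\<Phi> \<tau> I = level_sizes n (\<lambda>i\<in>{1..n}. \<tau> (?h I i)) (k + 1)" for \<tau> I
  have int: "integrable M (X g)" for g
  proof -
    have "Measurable.pred M (\<lambda>\<omega>. positive_levels {1..n} (\<lambda>i. \<xi> i \<omega>) g (k + 1))"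
      by (rule pred_positive_levels) (rule rv)
    then have "X g \<in> borel_measurable M" unfolding X_def by simp
    then show ?thesis by (rule integrable_const_bound[of _ 1, rotated]) (simp add: X_def)
  qed
  have rearr: "(\<integral>\<omega>. X (?h (\<Phi> \<tau> I)) \<omega> \<partial>M) = (\<integral>\<omega>. X (\<lambda>i\<in>{1..n}. \<tau> (?h I i)) \<omega> \<partial>M) \<and> \<Phi> \<tau> I \<in> index_sets n k"
    if \<tau>: "\<tau> \<in> ?S" and I: "I \<in> index_sets n k" for \<tau> I
  proof -
    obtain \<sigma> where \<sigma>: "\<sigma> permutes {1..n}" "\<Phi> \<tau> I \<in> index_sets n k"
        "(\<lambda>i\<in>{1..n}. (\<lambda>i\<in>{1..n}. \<tau> (?h I i)) (\<sigma> i)) = ?h (\<Phi> \<tau> I)"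
      using surjection_arrangement[OF n comp_surjections[OF composition_blocks(1)[OF n I] \<tau>]]
      unfolding \<Phi>_def by metis
    have "(\<integral>\<omega>. X (\<lambda>i\<in>{1..n}. (\<lambda>i\<in>{1..n}. \<tau> (?h I i)) (\<sigma> i)) \<omega> \<partial>M) =
        (\<integral>\<omega>. X (\<lambda>i\<in>{1..n}. \<tau> (?h I i)) \<omega> \<partial>M)"
      unfolding X_def by (rule exchangeable_positive_levels[OF _ ex \<sigma>(1)]) (rule rv)
    then show ?thesis using \<sigma>(2) unfolding \<sigma>(3) by blast
  qed
  \<comment> \<open>Almost surely the block sums add up to zero and are generic, so
    \<open>positive_orders_eq\<close> applies; \<open>k \<ge> 1\<close> excludes the exceptional
    case of a single block.\<close>
  have orders: "AE \<omega> in M. (\<Sum>\<tau>\<in>?S. X (\<lambda>i\<in>{1..n}. \<tau> (?h I i)) \<omega>) = stirling_parity_sum CARD('d) (k + 1)"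
    if I: "I \<in> index_sets n k" for I
    using br random_bridge_AE_generic_steps[OF rb n]
  proof eventually_elim
    case (elim \<omega>)
    let ?b = "\<lambda>i. \<xi> i \<omega>"
    note hI = composition_blocks(1)[OF n I]
    have "(\<Sum>\<tau>\<in>?S. X (\<lambda>i\<in>{1..n}. \<tau> (?h I i)) \<omega>) = real (positive_orders (k + 1) (block_sum {1..n} ?b (?h I)))"
      unfolding X_def sum_of_bool_positive_levels[symmetric]
      by (intro sum.cong refl) (simp only: positive_levels_def levels_comp_surjection[OF finite_atLeastAtMost hI])
    also have "\<dots> = stirling_parity_sum CARD('d) (k + 1)"
    proof (subst positive_orders_eq)
      show "(\<Sum>i<k + 1. block_sum {1..n} ?b (?h I) i) = 0"
        using sum_block_sum[OF finite_atLeastAtMost hI, of ?b "\<lambda>_. True"] elim(1)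
        by (simp only: simp_thms Collect_mem_eq partial_sums_def)
      show "generic_steps {..<k + 1} (block_sum {1..n} ?b (?h I))"
        by (rule generic_steps_block_sum[OF _ elim(2) hI]) simp
    qed (use k in auto)
    finally show ?case .
  qed
  define T where "T = (\<Sum>I\<in>index_sets n k. \<integral>\<omega>. X (?h I) \<omega> \<partial>M)"
  \<comment> \<open>Reordering the blocks by a fixed \<open>\<tau>\<close> only permutes the index
    sets, so the total does not depend on \<open>\<tau>\<close>.\<close>
  have T: "T = (\<Sum>I\<in>index_sets n k. \<integral>\<omega>. X (\<lambda>i\<in>{1..n}. \<tau> (?h I i)) \<omega> \<partial>M)" if \<tau>: "\<tau> \<in> ?S" for \<tau>
  proof -
    have inj: "inj_on (\<Phi> \<tau>) (index_sets n k)"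
      unfolding \<Phi>_def by (rule inj_on_level_sizes_comp[OF n \<tau>])
    have "\<Phi> \<tau> ` index_sets n k = index_sets n k"
      by (rule endo_inj_surj[OF finite_index_sets _ inj]) (use rearr[OF \<tau>] in blast)
    with inj have "bij_betw (\<Phi> \<tau>) (index_sets n k) (index_sets n k)" by (simp only: bij_betw_def)
    then have "T = (\<Sum>I\<in>index_sets n k. \<integral>\<omega>. X (?h (\<Phi> \<tau> I)) \<omega> \<partial>M)"
      unfolding T_def by (rule sum.reindex_bij_betw[symmetric])
    then show ?thesis using rearr[OF \<tau>] by simp
  qed
  have "fact (k + 1) * T = (\<Sum>\<tau>\<in>?S. T)" by (simp add: card_surjections_self del: fact_Suc)
  also have "\<dots> = (\<Sum>\<tau>\<in>?S. \<Sum>I\<in>index_sets n k. \<integral>\<omega>. X (\<lambda>i\<in>{1..n}. \<tau> (?h I i)) \<omega> \<partial>M)"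
    by (intro sum.cong refl T)
  also have "\<dots> = (\<Sum>I\<in>index_sets n k. \<integral>\<omega>. (\<Sum>\<tau>\<in>?S. X (\<lambda>i\<in>{1..n}. \<tau> (?h I i)) \<omega>) \<partial>M)"
    by (subst sum.swap) (simp add: int)
  also have "\<dots> = (\<Sum>I\<in>index_sets n k. \<integral>\<omega>. stirling_parity_sum CARD('d) (k + 1) \<partial>M)"
    using orders int by (intro sum.cong refl integral_cong_AE) auto
  also have "\<dots> = real ((n - 1) choose k) * stirling_parity_sum CARD('d) (k + 1)"
    by (simp add: prob_space card_index_sets)
  finally have "fact (k + 1) * T = real ((n - 1) choose k) * stirling_parity_sum CARD('d) (k + 1)" .
  moreover have "(\<integral>\<omega>. M_count n k \<xi> \<omega> \<partial>M) = T / 2"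
  proof -
    have "M_count n k \<xi> = (\<lambda>\<omega>. 1 / 2 * (\<Sum>I\<in>index_sets n k. X (?h I) \<omega>))"
      unfolding M_count_def X_def index_sets_def[symmetric]
      by (intro ext arg_cong[where f = "(*) (1 / 2)"] sum.cong refl)
         (simp only: positive_levels_composition_blocks[OF n])
    then show ?thesis by (simp add: T_def int)
  qed
  ultimately show ?thesis by (simp add: field_simps del: fact_Suc)
qed

theorem theorem1p8:
  fixes M :: "'a measure" and n :: nat and \<xi> :: "nat \<Rightarrow> 'a \<Rightarrow> real ^ 'd"
  assumes n: "n \<ge> CARD('d) + 2"
    and prob: "prob_space M"
    and rv: "\<And>i. i \<in> {1..n} \<Longrightarrow> \<xi> i \<in> borel_measurable M"
    and Br: "bridge_property M n \<xi>"
    and Ex: "exchangeable M n \<xi>"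
    and GP: "general_position M n CARD('d) \<xi>"
  shows "\<forall>k\<in>{1..n - 1}.
      (\<integral>\<omega>. M_count n k \<xi> \<omega> \<partial>M) =
        1 / fact (k + 1) * real ((n - 1) choose k) *
          (\<Sum>r = 0..CARD('d) div 2. real (stirling (k + 1) (CARD('d) - 2 * r))) \<and>
      (\<forall>(N :: 'b measure) (\<eta> :: nat \<Rightarrow> 'b \<Rightarrow> real ^ 'd). random_bridge N (k + 1) \<eta> \<longrightarrow>
        1 / fact (k + 1) * real ((n - 1) choose k) *
          (\<Sum>r = 0..CARD('d) div 2. real (stirling (k + 1) (CARD('d) - 2 * r))) =
        real ((n - 1) choose k) * (\<integral>\<omega>. M_count (k + 1) k \<eta> \<omega> \<partial>N))"
proof (intro ballI conjI allI impI)
  fix k assume k: "k \<in> {1..n - 1}"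
  \<comment> \<open>Hence the assumed general position is the one built into
    \<open>random_bridge\<close>.\<close>
  have "min CARD('d) (n - 1) = CARD('d)" using n by simp
  then have "random_bridge M n \<xi>"
    using prob rv Br Ex GP by (simp add: random_bridge_def)
  from expectation_M_count[OF this k]
  show "(\<integral>\<omega>. M_count n k \<xi> \<omega> \<partial>M) = 1 / fact (k + 1) * real ((n - 1) choose k) *
      (\<Sum>r = 0..CARD('d) div 2. real (stirling (k + 1) (CARD('d) - 2 * r)))"
    by (simp add: stirling_parity_sum_def del: fact_Suc)
  fix N :: "'b measure" and \<eta> :: "nat \<Rightarrow> 'b \<Rightarrow> real ^ 'd"
  assume "random_bridge N (k + 1) \<eta>"
  \<comment> \<open>The same formula with \<open>k + 1\<close> steps, where the binomial coefficient
    is 1. It covers \<open>k < CARD('d)\<close>, where general position in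
    \<open>random_bridge\<close> means independence of all \<open>k\<close> partial sums.\<close>
  from expectation_M_count[OF this, of k] k
  show "1 / fact (k + 1) * real ((n - 1) choose k) *
      (\<Sum>r = 0..CARD('d) div 2. real (stirling (k + 1) (CARD('d) - 2 * r))) =
      real ((n - 1) choose k) * (\<integral>\<omega>. M_count (k + 1) k \<eta> \<omega> \<partial>N)"
    by (simp add: stirling_parity_sum_def del: fact_Suc)
qed

end
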